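(* Let $\tau$ be a tau function of the Pfaff–Toda hierarchy, and write $\tau(s,r,\boldsymbol a,\bar{\boldsymbol a})$ for $\tau$ evaluated at $\boldsymbol t+\boldsymbol a$, $\bar{\boldsymbol t}+\bar{\boldsymbol a}$ (so $\tau(s,r,0,0)=\tau(s,r)$). Then for parameters $\lambda\neq\mu$ the following hold (as identities of expansions in $\lambda^{-1},\mu^{-1}$ for (1a),(1b); in $\lambda,\mu$ for (2a),(2b); in $\lambda^{-1},\mu$ for (3a),(3b)): (1a) $-\frac{\mu}{\lambda-\mu}\tau(s+1,r,[\mu^{-1}],0)\tau(s+1,r+1,[\lambda^{-1}],0)-\frac{\lambda}{\mu-\lambda}\tau(s+1,r,[\lambda^{-1}],0)\tau(s+1,r+1,[\mu^{-1}],0)+\frac1{\lambda\mu}\tau(s+2,r+1,[\lambda^{-1}]+[\mu^{-1}],0)\tau(s,r)=\tau(s+1,r+1,[\lambda^{-1}]+[\mu^{-1}],0)\tau(s+1,r)$; (1b) $-\frac{\mu}{\lambda-\mu}\tau(s,r+1,[\mu^{-1}],0)\tau(s+1,r+1,[\lambda^{-1}],0)-\frac{\lambda}{\mu-\lambda}\tau(s,r+1,[\lambda^{-1}],0)\tau(s+1,r+1,[\mu^{-1}],0)+\frac1{\lambda\mu}\tau(s+1,r+2,[\lambda^{-1}]+[\mu^{-1}],0)\tau(s,r)=\tau(s+1,r+1,[\lambda^{-1}]+[\mu^{-1}],0)\tau(s,r+1)$; (2a) $\tau(s,r+1,0,[\lambda]+[\mu])\tau(s,r)=\frac{\lambda}{\lambda-\mu}\tau(s,r,0,[\mu])\tau(s,r+1,0,[\lambda])+\frac{\mu}{\mu-\lambda}\tau(s,r,0,[\lambda])\tau(s,r+1,0,[\mu])+\lambda\mu\,\tau(s-1,r+1,0,[\lambda]+[\mu])\tau(s+1,r)$;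 (2b) $\tau(s,r+1,0,[\lambda]+[\mu])\tau(s+1,r+1)=\frac{\lambda}{\lambda-\mu}\tau(s+1,r+1,0,[\mu])\tau(s,r+1,0,[\lambda])+\frac{\mu}{\mu-\lambda}\tau(s+1,r+1,0,[\lambda])\tau(s,r+1,0,[\mu])+\lambda\mu\,\tau(s,r+2,0,[\lambda]+[\mu])\tau(s+1,r)$; (3a) $\lambda^{-1}\tau(s,r,0,[\mu])\tau(s+1,r+1,[\lambda^{-1}],0)-\lambda^{-1}\tau(s+1,r+1,[\lambda^{-1}],[\mu])\tau(s,r)=\mu\,\tau(s+1,r,[\lambda^{-1}],0)\tau(s,r+1,0,[\mu])-\mu\,\tau(s,r+1,[\lambda^{-1}],[\mu])\tau(s+1,r)$; (3b) $\lambda^{-1}\tau(s-1,r+1,0,[\mu])\tau(s+1,r+1,[\lambda^{-1}],0)-\lambda^{-1}\tau(s,r+2,[\lambda^{-1}],[\mu])\tau(s,r)=\mu^{-1}\tau(s,r+1,[\lambda^{-1}],0)\tau(s,r+1,0,[\mu])-\mu^{-1}\tau(s,r+1,[\lambda^{-1}],[\mu])\tau(s,r+1)$.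
   Context: Let $\boldsymbol t=(t_1,t_2,\dots)$, $\bar{\boldsymbol t}=(\bar t_1,\bar t_2,\dots)$ be infinite sequences of continuous variables and $s,r\in\mathbb Z$. Put $[z]=(z,z^2/2,z^3/3,\dots)$, $\xi(\boldsymbol t,z)=\sum_{k\ge1}t_kz^k$. For a formal Laurent series $f(z)=\sum_na_nz^n$ write $\oint\frac{dz}{2\pi i}f(z)=a_{-1}$. A tau function of the Pfaff–Toda hierarchy is a nowhere vanishing function $\tau(s,r,\boldsymbol t,\bar{\boldsymbol t})$ such that for all $(s,r,\boldsymbol t,\bar{\boldsymbol t})$, $(s',r',\boldsymbol t',\bar{\boldsymbol t}')$: $$\oint\frac{dz}{2\pi i}z^{s'+r'-s-r}e^{\xi(\boldsymbol t'-\boldsymbol t,z)}\tau(s',r',\boldsymbol t'-[z^{-1}],\bar{\boldsymbol t}')\tau(s,r,\boldsymbol t+[z^{-1}],\bar{\boldsymbol t})+\oint\frac{dz}{2\pi i}z^{s+r-s'-r'-4}e^{\xi(\boldsymbol t-\boldsymbol t',z)}\tau(s'+1,r'+1,\boldsymbol t'+[z^{-1}],\bar{\boldsymbol t}')\tau(s-1,r-1,\boldsymbol t-[z^{-1}],\bar{\boldsymbol t})$$ $$=\oint\frac{dz}{2\pi i}z^{s'-r'-s+r}e^{\xi(\bar{\boldsymbol t}'-\bar{\boldsymbol t},z^{-1})}\tau(s'+1,r',\boldsymbol t',\bar{\boldsymbol t}'-[z])\tau(s-1,r,\boldsymbol t,\bar{\boldsymbol t}+[z])+\oint\frac{dz}{2\pi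 i}z^{s-r-s'+r'}e^{\xi(\bar{\boldsymbol t}-\bar{\boldsymbol t}',z^{-1})}\tau(s',r'+1,\boldsymbol t',\bar{\boldsymbol t}'+[z])\tau(s,r-1,\boldsymbol t,\bar{\boldsymbol t}-[z]),$$ where the two left-hand integrands are expanded at $z=\infty$ and the two right-hand ones at $z=0$. Abbreviate $\tau(s,r)=\tau(s,r,\boldsymbol t,\bar{\boldsymbol t})$. *)

theory Defs
  imports "HOL-Analysis.Analysis" "HOL-Library.Poly_Mapping"
begin

type_synonym 'v mono = "'v \<Rightarrow>\<^sub>0 nat"
type_synonym 'v mpoly = "'v mono \<Rightarrow>\<^sub>0 complex"
type_synonym 'v mps = "'v mono \<Rightarrow> complex"

definition pVar :: "'v \<Rightarrow> 'v mpoly" where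
  "pVar v = Poly_Mapping.single (Poly_Mapping.single v 1) 1"

definition pConst :: "complex \<Rightarrow> 'v mpoly" where
  "pConst c = Poly_Mapping.single 0 c"

definition ps_of_poly :: "'v mpoly \<Rightarrow> 'v mps" where
  "ps_of_poly p = (\<lambda>m. Poly_Mapping.lookup p m)"

definition ps_zero :: "'v mps" where
  "ps_zero = (\<lambda>m. 0)"

definition ps_one :: "'v mps" where
  "ps_one = (\<lambda>m. if m = 0 then 1 else 0)"

definition ps_add :: "'v mps \<Rightarrow> 'v mps \<Rightarrow> 'v mps" where
  "ps_add f g = (\<lambda>m. f m + g m)"

definition ps_diff :: "'v mps \<Rightarrow> 'v mps \<Rightarrow> 'v mps" where
  "ps_diff f g = (\<lambda>m. f m - g m)"

text \<open>Cauchy product (the index set is finite).\<close>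
definition ps_mult :: "'v mps \<Rightarrow> 'v mps \<Rightarrow> 'v mps" where
  "ps_mult f g = (\<lambda>m. \<Sum>(a, b) \<in> {(a, b). a + b = m}. f a * g b)"

primrec ps_pow :: "'v mps \<Rightarrow> nat \<Rightarrow> 'v mps" where
  "ps_pow f 0 = ps_one"
| "ps_pow f (Suc n) = ps_mult f (ps_pow f n)"

text \<open>Coefficientwise infinite sum of a family of power series (in all uses
  below, for every monomial only finitely many members contribute).\<close>
definition ps_infsum :: "('i \<Rightarrow> 'v mps) \<Rightarrow> 'v mps" where
  "ps_infsum F = (\<lambda>m. \<Sum>\<^sub>\<infinity>i. F i m)"

text \<open>Exponential of a power series (used for series without constant term).\<close>
definition ps_exp :: "'v mps \<Rightarrow> 'v mps" where
  "ps_exp f = ps_infsum (\<lambda>n. (\<lambda>m. ps_pow f n m / of_nat (fact n)))"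

definition ps_subst :: "('v \<Rightarrow> 'w mpoly) \<Rightarrow> 'v mps \<Rightarrow> 'w mps" where
  "ps_subst \<sigma> f = ps_infsum (\<lambda>a. (\<lambda>m. f a * Poly_Mapping.lookup (\<Prod>v \<in> Poly_Mapping.keys a. \<sigma> v ^ Poly_Mapping.lookup a v) m))"

definition ps_coeff_var :: "'v \<Rightarrow> nat \<Rightarrow> 'v mps \<Rightarrow> 'v mps" where
  "ps_coeff_var u n f = (\<lambda>m. if Poly_Mapping.lookup m u = 0 then f (m + Poly_Mapping.single u n) else 0)"

definition ps_coeff_var_int :: "'v \<Rightarrow> int \<Rightarrow> 'v mps \<Rightarrow> 'v mps" where
  "ps_coeff_var_int u k f = (if k < 0 then ps_zero else ps_coeff_var u (nat k) f)"

text \<open>Variables of a tau function: Tv k stands for t_(k+1), Tbv k for tbar_(k+1).\<close>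
datatype tv = Tv nat | Tbv nat

text \<open>Variables used for the identities: P v is the variable v at the point
  (t, tbar), Q v the same variable at the second point (t', tbar'), Z the
  spectral variable of the contour integrals, L and M the two spectral
  parameters (lambda^(-1) / lambda and mu^(-1) / mu, see the theorem).\<close>
datatype var = P tv | Q tv | Z | L | M

type_synonym tau = "int \<Rightarrow> int \<Rightarrow> tv mps"

text \<open>k-th component (index shifted by one) of the Miwa vector [u] = (u, u^2/2, u^3/3, ...).\<close>
definition miwa :: "var \<Rightarrow> nat \<Rightarrow> var mpoly" where
  "miwa u k = pConst (1 / of_nat (Suc k)) * pVar u ^ Suc k"

text \<open>tau evaluated at (t + a, tbar + b), where (t, tbar) are the variables
  selected by base (P or Q), a k / b k being the shifts of t_(k+1) / tbar_(k+1).\<close>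
definition tau_at :: "tv mps \<Rightarrow> (tv \<Rightarrow> var) \<Rightarrow> (nat \<Rightarrow> var mpoly) \<Rightarrow> (nat \<Rightarrow> var mpoly) \<Rightarrow> var mps" where
  "tau_at f base a b = ps_subst (\<lambda>v. pVar (base v) + (case v of Tv k \<Rightarrow> a k | Tbv k \<Rightarrow> b k)) f"

definition exp_xi :: "(nat \<Rightarrow> var mpoly) \<Rightarrow> var \<Rightarrow> var mps" where
  "exp_xi d u = ps_exp (ps_infsum (\<lambda>k. ps_of_poly (d k * pVar u ^ Suc k)))"

text \<open>Residue (coefficient of z^(-1)) of z^N E(z) F(z^(-1)) expanded at z = infinity,
  where E is a series in Z = z and F a series in Z = z^(-1).\<close>
definition res_inf :: "int \<Rightarrow> var mps \<Rightarrow> var mps \<Rightarrow> var mps" where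
  "res_inf N E F = ps_infsum (\<lambda>n::nat. ps_mult (ps_coeff_var Z n E) (ps_coeff_var_int Z (int n + N + 1) F))"

text \<open>Residue (coefficient of z^(-1)) of z^N E(z^(-1)) G(z) expanded at z = 0,
  where E is a series in Z = z^(-1) and G a series in Z = z.\<close>
definition res_zero :: "int \<Rightarrow> var mps \<Rightarrow> var mps \<Rightarrow> var mps" where
  "res_zero N E G = ps_infsum (\<lambda>n::nat. ps_mult (ps_coeff_var Z n E) (ps_coeff_var_int Z (int n - N - 1) G))"

abbreviation tP :: "nat \<Rightarrow> var mpoly" where "tP k \<equiv> pVar (P (Tv k))"
abbreviation tQ :: "nat \<Rightarrow> var mpoly" where "tQ k \<equiv> pVar (Q (Tv k))"
abbreviation tbP :: "nat \<Rightarrow> var mpoly" where "tbP k \<equiv> pVar (P (Tbv k))"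
abbreviation tbQ :: "nat \<Rightarrow> var mpoly" where "tbQ k \<equiv> pVar (Q (Tbv k))"

definition noshift :: "nat \<Rightarrow> var mpoly" where "noshift k = 0"

definition pfaff_toda_tau :: "tau \<Rightarrow> bool" where
  "pfaff_toda_tau \<tau> \<longleftrightarrow>
     (\<forall>s r. \<tau> s r 0 \<noteq> 0) \<and>
     (\<forall>s r s' r'.
        ps_add
          (res_inf (s' + r' - s - r) (exp_xi (\<lambda>k. tQ k - tP k) Z)
             (ps_mult (tau_at (\<tau> s' r') Q (\<lambda>k. - miwa Z k) noshift)
                      (tau_at (\<tau> s r) P (\<lambda>k. miwa Z k) noshift)))
          (res_inf (s + r - s' - r' - 4) (exp_xi (\<lambda>k. tP k - tQ k) Z)
             (ps_mult (tau_at (\<tau> (s' + 1) (r' + 1)) Q (\<lambda>k. miwa Z k) noshift)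
                      (tau_at (\<tau> (s - 1) (r - 1)) P (\<lambda>k. - miwa Z k) noshift)))
      = ps_add
          (res_zero (s' - r' - s + r) (exp_xi (\<lambda>k. tbQ k - tbP k) Z)
             (ps_mult (tau_at (\<tau> (s' + 1) r') Q noshift (\<lambda>k. - miwa Z k))
                      (tau_at (\<tau> (s - 1) r) P noshift (\<lambda>k. miwa Z k))))
          (res_zero (s - r - s' + r') (exp_xi (\<lambda>k. tbP k - tbQ k) Z)
             (ps_mult (tau_at (\<tau> s' (r' + 1)) Q noshift (\<lambda>k. miwa Z k))
                      (tau_at (\<tau> s (r - 1)) P noshift (\<lambda>k. - miwa Z k)))))"

definition tauS :: "tau \<Rightarrow> int \<Rightarrow> int \<Rightarrow> (nat \<Rightarrow> var mpoly) \<Rightarrow> (nat \<Rightarrow> var mpoly) \<Rightarrow> var mps" where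
  "tauS \<tau> s r a b = tau_at (\<tau> s r) P a b"

definition ps_pmult :: "var mpoly \<Rightarrow> var mps \<Rightarrow> var mps" where
  "ps_pmult p f = ps_mult (ps_of_poly p) f"

definition miwa2 :: "var \<Rightarrow> var \<Rightarrow> nat \<Rightarrow> var mpoly" where
  "miwa2 u w k = miwa u k + miwa w k"

end

theory Submission
  imports Defs "HOL-Computational_Algebra.Formal_Power_Series"
begin

unbundle no vec_syntax
unbundle fps_syntax

text \<open>
  Each identity is the bilinear equation at a particular point: shifting \<open>t'\<close> and \<open>tbar'\<close>
  against \<open>t\<close> and \<open>tbar\<close> by one or two Miwa vectors turns every exponential factor into a product
  of factors \<open>1 / (1 - u z)\<close> or \<open>1 - u z\<close>, so that each residue is either an evaluation at \<open>z\<^sup>-\<^sup>1 = u\<close>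
  or a single low order coefficient. With \<open>(s', r'; s, r)\<close> written for the indices of the bilinear
  equation, the choices are \<open>(s + 1, r; s + 1, r + 1)\<close> for (1a), \<open>(s, r + 1; s + 1, r + 1)\<close> for (1b)
  and (2b), \<open>(s - 1, r; s + 1, r + 1)\<close> for (2a), \<open>(s, r; s + 1, r + 1)\<close> for (3a) and
  \<open>(s - 1, r + 1; s + 1, r + 1)\<close> for (3b).

  All infinite sums are controlled by the grading in which \<open>t\<^sub>k\<close> and \<open>tbar\<^sub>k\<close> have weight \<open>k\<close> and
  the spectral variables have weight 1: there are finitely many monomials of each weight, and the
  substitutions that occur do not lower the weight.
\<close>

section \<open>The ring of power series in weighted variables\<close>

text \<open>Put A = s' + r' - s - r and B = s' - r' - s + r. After z is inverted on the right-hand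
  side, the four residues are the coefficients of z^-k with k = A + 1, - A - 3, - B - 1, B - 1 in
  turn. The two exponentials on one side carry opposite signs, so a shift by d Miwa vectors pairs a
  product of d geometric series with a polynomial of degree d. The offsets 0 and -2 suit d = 2: one
  residue is a divided difference of evaluations, the other is the top coefficient of the polynomial
  times the value at 0. For d = 0 the same offsets, in either order, kill one residue and leave a
  value at 0 in the other; for d = 1 the offsets are -1, -1 or 1, -3. The resulting values of A and
  B give the index choices. Evaluation at u takes [u] away from the primed shift and adds it to the
  unprimed one, which is how the Miwa vectors get distributed over the two factors. Divided
  differences and shifted evaluations stay in the ring because the identities are multiplied by l -
  m or by m instead of dividing.\<close>

class weighted =
  fixes wt :: "'a \<Rightarrow> nat"
  assumes wt_pos: "wt v > 0"
    and finite_wt_le: "finite {v. wt v \<le> n}"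

definition mwt :: "'v::weighted mono \<Rightarrow> nat" where
  "mwt m = (\<Sum>v\<in>Poly_Mapping.keys m. wt v * Poly_Mapping.lookup m v)"

lemma mwt_superset:
  assumes "finite A" "Poly_Mapping.keys m \<subseteq> A"
  shows "mwt m = (\<Sum>v\<in>A. wt v * Poly_Mapping.lookup m v)"
  unfolding mwt_def
  by (rule sum.mono_neutral_left) (use assms in \<open>auto simp: in_keys_iff\<close>)

lemma mwt_plus [simp]: "mwt (a + b) = mwt a + mwt b"
proof -
  let ?A = "Poly_Mapping.keys a \<union> Poly_Mapping.keys b"
  have "mwt (a + b) = (\<Sum>v\<in>?A. wt v * Poly_Mapping.lookup (a + b) v)"
    by (rule mwt_superset) (use Poly_Mapping.keys_add[of a b] in auto)
  also have "\<dots> = mwt a + mwt b"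
    by (simp add: mwt_superset[of ?A a] mwt_superset[of ?A b] lookup_add algebra_simps sum.distrib)
  finally show ?thesis .
qed

lemma mwt_zero [simp]: "mwt 0 = 0"
  by (simp add: mwt_def)

lemma mwt_single [simp]: "mwt (Poly_Mapping.single v k) = wt v * k"
  by (cases "k = 0") (simp_all add: mwt_def)

lemma lookup_le_mwt: "wt v * Poly_Mapping.lookup m v \<le> mwt m"
proof (cases "v \<in> Poly_Mapping.keys m")
  case True
  then show ?thesis unfolding mwt_def by (intro member_le_sum) auto
qed (auto simp: in_keys_iff)

lemma lookup_le_mwt': "Poly_Mapping.lookup m v \<le> mwt m"
  using lookup_le_mwt[of v m] wt_pos[of v]
  by (metis Suc_leI le_trans mult_le_mono1 nat_mult_1 One_nat_def)

text \<open>A monomial of weight at most \<open>n\<close> involves only the finitely many variables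
  of weight at most \<open>n\<close>, with exponents at most \<open>n\<close>; such exponent
  functions form a finite set.\<close>

lemma finite_mwt_le: "finite {m :: 'v::weighted mono. mwt m \<le> n}"
proof -
  let ?V = "{v :: 'v. wt v \<le> n}"
  have "finite {f. \<forall>x. (x \<in> ?V \<longrightarrow> f x \<in> {..n}) \<and> (x \<notin> ?V \<longrightarrow> f x = 0)}"
    by (rule finite_set_of_finite_funs) (auto intro: finite_wt_le)
  moreover have "Poly_Mapping.lookup ` {m :: 'v mono. mwt m \<le> n}
    \<subseteq> {f. \<forall>x. (x \<in> ?V \<longrightarrow> f x \<in> {..n}) \<and> (x \<notin> ?V \<longrightarrow> f x = 0)}"
  proof -
    have "Poly_Mapping.lookup m v \<le> n" if "mwt m \<le> n" for m :: "'v mono" and v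
      using lookup_le_mwt'[of m v] that by simp
    moreover have "Poly_Mapping.lookup m v = 0" if "mwt m \<le> n" "\<not> wt v \<le> n" for m :: "'v mono" and v
      using lookup_le_mwt[of v m] that by (cases "Poly_Mapping.lookup m v") auto
    ultimately show ?thesis by auto
  qed
  ultimately have "finite (Poly_Mapping.lookup ` {m :: 'v mono. mwt m \<le> n})"
    by (rule rev_finite_subset)
  then show ?thesis
    by (rule finite_imageD) (simp add: inj_on_def poly_mapping_eqI)
qed

lemma finite_mwt_less: "finite {m :: 'v::weighted mono. mwt m < n}"
  by (rule finite_subset[OF _ finite_mwt_le[of n]]) auto

lemma finite_splits: "finite {(a, b). a + b = (m :: 'v::weighted mono)}"
  by (rule finite_subset[of _ "{a. mwt a \<le> mwt m} \<times> {b. mwt b \<le> mwt m}"])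
    (auto intro: finite_mwt_le)

text \<open>A separate type lets the Cauchy product carry a ring instance, so that the algebra can
  be left to the simplifier; \<open>Ps\<close> and \<open>coeff\<close> translate to and from the
  given functions.\<close>

typedef 'v ps = "UNIV :: 'v mps set"
  morphisms coeff Ps ..

lemma coeff_Ps [simp]: "coeff (Ps f) = f"
  by (simp add: Ps_inverse)

lemma Ps_inject' [simp]: "Ps f = Ps g \<longleftrightarrow> f = g"
  by (simp add: Ps_inject)

lemma ps_eqI: "(\<And>m. coeff f m = coeff g m) \<Longrightarrow> f = g"
  by (metis coeff_inverse ext)

instantiation ps :: (weighted) comm_ring_1
begin

definition "0 = Ps ps_zero"
definition "1 = Ps ps_one"
definition "f + g = Ps (ps_add (coeff f) (coeff g))"
definition "f - g = Ps (ps_diff (coeff f) (coeff g))"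
definition "- f = Ps (ps_diff ps_zero (coeff f))"
definition "f * g = Ps (ps_mult (coeff f) (coeff g))"

lemma mult_commute_aux: "ps_mult f g = ps_mult g (f :: 'a mps)"
  unfolding ps_mult_def
  by (rule ext, rule sum.reindex_bij_witness[of _ prod.swap prod.swap]) (auto simp: add.commute)

text \<open>Both sides sum over the decompositions of \<open>m\<close> into three monomials; the
  reindexing only changes which two of them are bracketed.\<close>

lemma mult_assoc_aux: "ps_mult (ps_mult f g) h = ps_mult f (ps_mult g (h :: 'a mps))"
proof
  fix m :: "'a mono"
  have "ps_mult (ps_mult f g) h m
    = (\<Sum>p\<in>{(a, b). a + b = m}. \<Sum>q\<in>{(c, d). c + d = fst p}. f (fst q) * g (snd q) * h (snd p))"
    by (simp add: ps_mult_def case_prod_beta sum_distrib_right)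
  also have "\<dots> = (\<Sum>(p, q)\<in>Sigma {(a, b). a + b = m} (\<lambda>p. {(c, d). c + d = fst p}).
      f (fst q) * g (snd q) * h (snd p))"
    by (rule sum.Sigma) (auto intro: finite_splits)
  also have "\<dots> = (\<Sum>(p, q)\<in>Sigma {(a, b). a + b = m} (\<lambda>p. {(c, d). c + d = snd p}).
      f (fst p) * (g (fst q) * h (snd q)))"
    by (rule sum.reindex_bij_witness[of _
          "\<lambda>((a, b), (c, d)). ((a + c, d), (a, c))" "\<lambda>((a, b), (c, d)). ((c, d + b), (d, b))"])
      (auto simp: add.assoc)
  also have "\<dots> = (\<Sum>p\<in>{(a, b). a + b = m}. \<Sum>q\<in>{(c, d). c + d = snd p}. f (fst p) * (g (fst q) * h (snd q)))"
    by (rule sum.Sigma[symmetric]) (auto intro: finite_splits)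
  also have "\<dots> = ps_mult f (ps_mult g h) m"
    by (simp add: ps_mult_def case_prod_beta sum_distrib_left)
  finally show "ps_mult (ps_mult f g) h m = ps_mult f (ps_mult g h) m" .
qed

lemma one_mult_aux: "ps_mult ps_one f = (f :: 'a mps)"
proof
  fix m :: "'a mono"
  have "ps_mult ps_one f m = (\<Sum>(a, b)\<in>{(0 :: 'a mono, m)}. ps_one a * f b)"
    unfolding ps_mult_def
    by (rule sum.mono_neutral_right) (auto simp: finite_splits ps_one_def split: if_splits)
  then show "ps_mult ps_one f m = f m"
    by (simp add: ps_one_def)
qed

instance
proof
  fix f g h :: "'a ps"
  show "f * g * h = f * (g * h)"
    by (simp add: times_ps_def mult_assoc_aux)
  show "f * g = g * f"
    by (simp add: times_ps_def mult_commute_aux)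
  show "1 * f = f"
    by (simp add: times_ps_def one_ps_def one_mult_aux coeff_inverse)
  show "(f + g) * h = f * h + g * h"
    by (simp add: times_ps_def plus_ps_def ps_add_def ps_mult_def case_prod_beta sum.distrib algebra_simps)
  show "(0::'a ps) \<noteq> 1"
    by (auto simp: zero_ps_def one_ps_def ps_zero_def ps_one_def fun_eq_iff)
qed (auto simp: zero_ps_def plus_ps_def minus_ps_def uminus_ps_def ps_zero_def ps_add_def ps_diff_def
    coeff_inverse algebra_simps)

end

lemma coeff_zero [simp]: "coeff 0 m = 0"
  and coeff_one: "coeff 1 m = (if m = 0 then 1 else 0)"
  and coeff_add [simp]: "coeff (f + g) m = coeff f m + coeff g m"
  and coeff_diff [simp]: "coeff (f - g) m = coeff f m - coeff g m"
  and coeff_minus [simp]: "coeff (- f) m = - coeff f m"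
  and coeff_mult: "coeff (f * g) m = (\<Sum>(a, b)\<in>{(a, b). a + b = m}. coeff f a * coeff g b)"
  by (simp_all add: zero_ps_def one_ps_def plus_ps_def minus_ps_def uminus_ps_def times_ps_def
      ps_zero_def ps_one_def ps_add_def ps_diff_def ps_mult_def)

lemma coeff_sum [simp]: "coeff (sum F A) m = (\<Sum>i\<in>A. coeff (F i) m)"
  by (induction A rule: infinite_finite_induct) auto

definition const :: "complex \<Rightarrow> 'v::weighted ps" where
  "const c = Ps (\<lambda>m. if m = 0 then c else 0)"

lemma coeff_const: "coeff (const c) m = (if m = 0 then c else 0)"
  by (simp add: const_def)

lemma coeff_const_mult [simp]: "coeff (const c * f) m = c * coeff (f :: 'v::weighted ps) m"
proof -
  have "coeff (const c * f) m = (\<Sum>(a, b)\<in>{(0 :: 'v mono, m)}. coeff (const c) a * coeff f b)"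
    unfolding coeff_mult
    by (rule sum.mono_neutral_right) (auto simp: finite_splits coeff_const split: if_splits)
  then show ?thesis
    by (simp add: coeff_const)
qed

lemma const_simps [simp]: "const 0 = 0" "const 1 = 1" "const (- c) = - const c"
  and const_add: "const (c + d) = const c + const d"
  and const_mult: "const (c * d) = const c * const d"
  by (auto intro!: ps_eqI simp: coeff_one coeff_const)

lemma const_of_nat [simp]: "const (of_nat n) = of_nat n"
  by (induction n) (simp_all add: const_add)

lemma coeff_of_nat_mult [simp]: "coeff (of_nat n * f) m = of_nat n * coeff f m"
  by (metis coeff_const_mult const_of_nat)

lemma of_nat_mult_cancel_ps:
  "n > 0 \<Longrightarrow> of_nat n * f = of_nat n * g \<Longrightarrow> f = (g :: 'v::weighted ps)"
  by (metis coeff_of_nat_mult mult_left_cancel of_nat_eq_0_iff ps_eqI less_numeral_extra(3))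

section \<open>Weight filtration and substitution\<close>

definition ord_ge :: "nat \<Rightarrow> 'v::weighted ps set" where
  "ord_ge n = {f. \<forall>m. mwt m < n \<longrightarrow> coeff f m = 0}"

lemma ord_geD: "f \<in> ord_ge n \<Longrightarrow> mwt m < n \<Longrightarrow> coeff f m = 0"
  by (simp add: ord_ge_def)

lemma ord_ge_0 [simp]: "f \<in> ord_ge 0"
  by (simp add: ord_ge_def)

lemma ord_ge_zero [simp]: "0 \<in> ord_ge n"
  by (simp add: ord_ge_def)

lemma ord_ge_add: "f \<in> ord_ge n \<Longrightarrow> g \<in> ord_ge n \<Longrightarrow> f + g \<in> ord_ge n"
  and ord_ge_diff: "f \<in> ord_ge n \<Longrightarrow> g \<in> ord_ge n \<Longrightarrow> f - g \<in> ord_ge n"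
  and ord_ge_minus: "f \<in> ord_ge n \<Longrightarrow> - f \<in> ord_ge n"
  and ord_ge_mono: "f \<in> ord_ge n \<Longrightarrow> k \<le> n \<Longrightarrow> f \<in> ord_ge k"
  by (simp_all add: ord_ge_def)

lemma ord_ge_mult:
  assumes "f \<in> ord_ge j" "g \<in> ord_ge k"
  shows "f * g \<in> ord_ge (j + k)"
proof -
  have "coeff f a * coeff g b = 0" if "mwt (a + b) < j + k" for a b
  proof -
    have "mwt a < j \<or> mwt b < k"
      using that by simp linarith
    then show ?thesis
      using assms by (auto simp: ord_ge_def)
  qed
  then show ?thesis
    unfolding ord_ge_def coeff_mult mem_Collect_eq by (intro allI impI sum.neutral ballI) (auto simp del: mult_eq_0_iff)
qed

lemma ord_ge_mult_right: "f \<in> ord_ge n \<Longrightarrow> f * g \<in> ord_ge n"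
  using ord_ge_mult[of f n g 0] by simp

lemma ord_ge_mult_left: "f \<in> ord_ge n \<Longrightarrow> g * f \<in> ord_ge n"
  using ord_ge_mult[of g 0 f n] by simp

lemma ord_ge_sum: "(\<And>i. i \<in> A \<Longrightarrow> F i \<in> ord_ge n) \<Longrightarrow> sum F A \<in> ord_ge n"
  by (induction A rule: infinite_finite_induct) (auto intro: ord_ge_add)

lemma ord_ge_power: "f \<in> ord_ge k \<Longrightarrow> f ^ n \<in> ord_ge (k * n)"
  by (induction n) (auto intro: ord_ge_mult)

lemma ord_ge_prod:
  "finite A \<Longrightarrow> (\<And>i. i \<in> A \<Longrightarrow> F i \<in> ord_ge (d i)) \<Longrightarrow> prod F A \<in> ord_ge (sum d A)"
  by (induction A rule: finite_induct) (auto intro: ord_ge_mult)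

text \<open>The weight topology is separated: the coefficient at \<open>m\<close> is already decided
  modulo \<open>ord_ge (Suc (mwt m))\<close>.\<close>

lemma eq_if_ord_ge:
  assumes "\<And>n. f - g \<in> ord_ge n"
  shows "f = g"
proof (rule ps_eqI)
  fix m
  have "coeff (f - g) m = 0"
    using ord_geD[OF assms, of m "Suc (mwt m)"] by simp
  then show "coeff f m = coeff g m" by simp
qed

text \<open>Convergence in the weight topology of a series whose \<open>n\<close>-th term has order at least \<open>n\<close>.\<close>
definition hsum :: "(nat \<Rightarrow> 'v::weighted ps) \<Rightarrow> 'v ps \<Rightarrow> bool" where
  "hsum X s \<longleftrightarrow> (\<forall>D. s - (\<Sum>n<D. X n) \<in> ord_ge D)"

lemma hsumD: "hsum X s \<Longrightarrow> s - (\<Sum>n<D. X n) \<in> ord_ge D"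
  by (simp add: hsum_def)

lemma hsum_unique:
  assumes "hsum X s" "hsum X t"
  shows "s = t"
proof (rule eq_if_ord_ge)
  fix n
  show "s - t \<in> ord_ge n"
    using ord_ge_diff[OF hsumD[OF assms(1), of n] hsumD[OF assms(2), of n]] by simp
qed

lemma hsum_coeff: "hsum X s \<Longrightarrow> mwt m < D \<Longrightarrow> coeff s m = (\<Sum>n<D. coeff (X n) m)"
  using ord_geD[OF hsumD, of X s m D] by simp

lemma hsum_diff:
  assumes "hsum X s" "hsum Y t"
  shows "hsum (\<lambda>n. X n - Y n) (s - t)"
  unfolding hsum_def
proof
  fix D
  have "s - t - (\<Sum>n<D. X n - Y n) = (s - (\<Sum>n<D. X n)) - (t - (\<Sum>n<D. Y n))"
    by (simp only: sum_subtractf) (simp add: algebra_simps)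
  then show "s - t - (\<Sum>n<D. X n - Y n) \<in> ord_ge D"
    using assms by (simp only: ord_ge_diff hsumD)
qed

lemma hsum_mult_left:
  assumes "hsum X s"
  shows "hsum (\<lambda>n. c * X n) (c * s)"
  unfolding hsum_def
proof
  fix D
  have "c * s - (\<Sum>n<D. c * X n) = c * (s - (\<Sum>n<D. X n))"
    by (simp add: sum_distrib_left algebra_simps)
  then show "c * s - (\<Sum>n<D. c * X n) \<in> ord_ge D"
    using assms by (simp add: ord_ge_mult_left hsumD)
qed

lemma hsum_finite:
  assumes "\<And>n. X n \<in> ord_ge n" "\<And>n. n \<ge> N \<Longrightarrow> X n = 0"
  shows "hsum X (\<Sum>n<N. X n)"
  unfolding hsum_def
proof
  fix D
  show "(\<Sum>n<N. X n) - (\<Sum>n<D. X n) \<in> ord_ge D"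
  proof (cases "N \<le> D")
    case True
    then have "(\<Sum>n<D. X n) = (\<Sum>n<N. X n)"
      by (intro sum.mono_neutral_right) (auto simp: assms(2))
    then show ?thesis by simp
  next
    case False
    then have "(\<Sum>n<N. X n) - (\<Sum>n<D. X n) = (\<Sum>n\<in>{..<N} - {..<D}. X n)"
      by (subst sum_diff) auto
    then show ?thesis
      by (auto intro!: ord_ge_sum ord_ge_mono[OF assms(1)])
  qed
qed

lemma hsum_shift:
  assumes "hsum X s" "\<And>n. X n \<in> ord_ge n"
  shows "hsum (\<lambda>n. X (Suc n)) (s - X 0)"
  unfolding hsum_def
proof
  fix D
  have "s - X 0 - (\<Sum>n<D. X (Suc n)) = s - (\<Sum>n<Suc D. X n)"
    by (simp only: sum.lessThan_Suc_shift diff_diff_eq)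
  then show "s - X 0 - (\<Sum>n<D. X (Suc n)) \<in> ord_ge D"
    by (metis ord_ge_mono[OF hsumD[OF assms(1)]] le_add2 plus_1_eq_Suc)
qed

text \<open>The factor \<open>u\<close> raises the order by one and so makes up for the partial sum
  that loses a term when the index is delayed.\<close>

lemma hsum_unshift:
  assumes "hsum X s" "u \<in> ord_ge 1"
  shows "hsum (\<lambda>n. case n of 0 \<Rightarrow> 0 | Suc k \<Rightarrow> u * X k) (u * s)"
  unfolding hsum_def
proof
  fix D
  show "u * s - (\<Sum>n<D. case n of 0 \<Rightarrow> 0 | Suc k \<Rightarrow> u * X k) \<in> ord_ge D"
  proof (cases D)
    case (Suc d)
    have "u * s - (\<Sum>n<D. case n of 0 \<Rightarrow> 0 | Suc k \<Rightarrow> u * X k) = u * (s - (\<Sum>n<d. X n))"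
      unfolding Suc sum.lessThan_Suc_shift by (simp add: sum_distrib_left algebra_simps)
    then show ?thesis
      using ord_ge_mult[OF assms(2) hsumD[OF assms(1), of d]] Suc by simp
  qed simp
qed

text \<open>At a monomial of weight below \<open>D\<close> only the terms with \<open>n < D\<close>
  contribute, so the coefficientwise infinite sum is there a finite one.\<close>

lemma hsum_infsum:
  assumes "\<And>n. Ps (F n) \<in> ord_ge n"
  shows "hsum (\<lambda>n. Ps (F n)) (Ps (ps_infsum F))"
  unfolding hsum_def
proof
  fix D
  have "ps_infsum F m = (\<Sum>n<D. F n m)" if "mwt m < D" for m
  proof -
    have "F n m = 0" if "n \<notin> {..<D}" for n
      using ord_geD[OF assms, of m n] that \<open>mwt m < D\<close> by simp
    then have "ps_infsum F m = (\<Sum>\<^sub>\<infinity>n\<in>{..<D}. F n m)"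
      unfolding ps_infsum_def by (intro infsum_cong_neutral) auto
    then show ?thesis by simp
  qed
  then show "Ps (ps_infsum F) - (\<Sum>n<D. Ps (F n)) \<in> ord_ge D"
    by (simp add: ord_ge_def)
qed

section \<open>Substitution as a ring homomorphism\<close>

definition eval_mono :: "('v \<Rightarrow> 'a::comm_monoid_mult) \<Rightarrow> 'v mono \<Rightarrow> 'a" where
  "eval_mono \<rho> a = (\<Prod>v\<in>Poly_Mapping.keys a. \<rho> v ^ Poly_Mapping.lookup a v)"

lemma eval_mono_superset:
  assumes "finite A" "Poly_Mapping.keys a \<subseteq> A"
  shows "eval_mono \<rho> a = (\<Prod>v\<in>A. \<rho> v ^ Poly_Mapping.lookup a v)"
  unfolding eval_mono_def
  by (rule prod.mono_neutral_left) (use assms in \<open>auto simp: in_keys_iff\<close>)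

lemma eval_mono_plus: "eval_mono \<rho> (a + b) = eval_mono \<rho> a * eval_mono \<rho> b"
proof -
  let ?A = "Poly_Mapping.keys a \<union> Poly_Mapping.keys b"
  have "eval_mono \<rho> (a + b) = (\<Prod>v\<in>?A. \<rho> v ^ Poly_Mapping.lookup (a + b) v)"
    by (rule eval_mono_superset) (use Poly_Mapping.keys_add[of a b] in auto)
  also have "\<dots> = eval_mono \<rho> a * eval_mono \<rho> b"
    by (simp add: eval_mono_superset[of ?A a] eval_mono_superset[of ?A b] lookup_add power_add prod.distrib)
  finally show ?thesis .
qed

lemma eval_mono_zero [simp]: "eval_mono \<rho> 0 = 1"
  by (simp add: eval_mono_def)

lemma eval_mono_single [simp]: "eval_mono \<rho> (Poly_Mapping.single v k) = \<rho> v ^ k"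
  by (cases "k = 0") (simp_all add: eval_mono_def)

definition weight_raising :: "('v::weighted \<Rightarrow> 'w::weighted ps) \<Rightarrow> bool" where
  "weight_raising \<rho> \<longleftrightarrow> (\<forall>v. \<rho> v \<in> ord_ge (wt v))"

lemma eval_mono_ord_ge: "weight_raising \<rho> \<Longrightarrow> eval_mono \<rho> a \<in> ord_ge (mwt a)"
  unfolding eval_mono_def mwt_def
  by (intro ord_ge_prod ord_ge_power) (auto simp: weight_raising_def)

text \<open>The cutoff at the weight of \<open>m\<close> makes the sum finite by construction; for a
  weight raising \<open>\<rho>\<close> the omitted terms vanish, so nothing of the substitution is
  lost.\<close>

definition subst :: "('v::weighted \<Rightarrow> 'w::weighted ps) \<Rightarrow> 'v ps \<Rightarrow> 'w ps" where
  "subst \<rho> f = Ps (\<lambda>m. \<Sum>a | mwt a \<le> mwt m. coeff f a * coeff (eval_mono \<rho> a) m)"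

text \<open>Every bound above the weight of \<open>m\<close> yields the same coefficient, so a
  single cutoff can serve several series at once.\<close>

lemma coeff_subst:
  assumes "weight_raising \<rho>" "mwt m < D"
  shows "coeff (subst \<rho> f) m = (\<Sum>a | mwt a < D. coeff f a * coeff (eval_mono \<rho> a) m)"
  unfolding subst_def coeff_Ps
  by (rule sum.mono_neutral_left)
    (use assms in \<open>auto simp: finite_mwt_less intro: ord_geD[OF eval_mono_ord_ge]\<close>)

lemma subst_truncate:
  assumes "weight_raising \<rho>"
  shows "subst \<rho> f - (\<Sum>a | mwt a < D. const (coeff f a) * eval_mono \<rho> a) \<in> ord_ge D"
  using assms by (simp add: ord_ge_def coeff_subst)

lemma subst_add: "subst \<rho> (f + g) = subst \<rho> f + subst \<rho> g"
  and subst_diff: "subst \<rho> (f - g) = subst \<rho> f - subst \<rho> g"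
  and subst_minus: "subst \<rho> (- f) = - subst \<rho> f"
  and subst_zero [simp]: "subst \<rho> 0 = 0"
  by (auto intro!: ps_eqI simp: subst_def algebra_simps sum.distrib sum_subtractf sum_negf)

lemma subst_sum: "subst \<rho> (sum F A) = (\<Sum>i\<in>A. subst \<rho> (F i))"
  by (induction A rule: infinite_finite_induct) (auto simp: subst_add)

lemma subst_ord_ge:
  assumes "weight_raising \<rho>" "f \<in> ord_ge n"
  shows "subst \<rho> f \<in> ord_ge n"
  using assms by (auto simp: ord_ge_def coeff_subst intro!: sum.neutral)

lemma subst_const [simp]: "subst \<rho> (const c) = const c"
proof (rule ps_eqI)
  fix m
  have "coeff (subst \<rho> (const c)) m = (\<Sum>a\<in>{0}. coeff (const c) a * coeff (eval_mono \<rho> a) m)"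
    unfolding subst_def coeff_Ps
    by (rule sum.mono_neutral_right) (auto simp: finite_mwt_le coeff_const)
  then show "coeff (subst \<rho> (const c)) m = coeff (const c) m"
    by (simp add: coeff_const coeff_one)
qed

lemma subst_one [simp]: "subst \<rho> 1 = 1"
  using subst_const[of \<rho> 1] by simp

lemma subst_of_nat [simp]: "subst \<rho> (of_nat n) = of_nat n"
  using subst_const[of \<rho> "of_nat n"] by simp

text \<open>Modulo \<open>ord_ge D\<close> both factors may be replaced by finite sums of monomials.
  In their product, pairs whose joint weight reaches \<open>D\<close> do not touch the coefficient
  at \<open>m\<close>; the remaining pairs are grouped by \<open>a + b\<close>, which recovers the
  Cauchy product.\<close>

lemma subst_mult:
  fixes \<rho> :: "'v::weighted \<Rightarrow> 'w::weighted ps"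
  assumes "weight_raising \<rho>"
  shows "subst \<rho> (f * g) = subst \<rho> f * subst \<rho> g"
proof (rule ps_eqI)
  fix m :: "'w mono"
  define D where "D = Suc (mwt m)"
  define T where "T = (\<lambda>f. \<Sum>a | mwt a < D. const (coeff f a) * eval_mono \<rho> a)"
  have T: "subst \<rho> f - T f \<in> ord_ge D" for f
    using subst_truncate[OF assms] by (simp add: T_def)
  have z: "mwt a + mwt b < D" if "coeff (eval_mono \<rho> (a + b)) m \<noteq> 0" for a b
    using ord_geD[OF eval_mono_ord_ge[OF assms], of m "a + b"] that by (force simp: D_def)
  let ?h = "\<lambda>(a, b). coeff f a * coeff g b * coeff (eval_mono \<rho> (a + b)) m"
  have "subst \<rho> f * subst \<rho> g - T f * T g
      = (subst \<rho> f - T f) * subst \<rho> g + T f * (subst \<rho> g - T g)"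
    by (simp add: algebra_simps)
  also have "\<dots> \<in> ord_ge D"
    by (intro ord_ge_add ord_ge_mult_left ord_ge_mult_right T)
  finally have "coeff (subst \<rho> f * subst \<rho> g) m = coeff (T f * T g) m"
    using ord_geD[of _ D m] by (fastforce simp: D_def)
  also have "T f * T g = (\<Sum>a | mwt a < D. \<Sum>b | mwt b < D.
      const (coeff f a * coeff g b) * eval_mono \<rho> (a + b))"
    by (simp add: T_def sum_product const_mult eval_mono_plus mult_ac)
  also have "coeff \<dots> m = (\<Sum>p\<in>{a. mwt a < D} \<times> {b. mwt b < D}. ?h p)"
    by (simp add: sum.cartesian_product case_prod_beta)
  also have "\<dots> = (\<Sum>p\<in>{(a, b). mwt (a + b) < D}. ?h p)"
    by (rule sum.mono_neutral_right) (auto simp: finite_mwt_less dest: z)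
  also have "\<dots> = (\<Sum>c | mwt c < D. \<Sum>p\<in>{p \<in> {(a, b). mwt (a + b) < D}. (case p of (a, b) \<Rightarrow> a + b) = c}. ?h p)"
  proof (rule sum.group[symmetric])
    show "finite {(a, b). mwt (a + b :: 'v mono) < D}"
      by (rule finite_subset[of _ "{a. mwt a < D} \<times> {b. mwt b < D}"]) (auto simp: finite_mwt_less)
  qed (auto simp: finite_mwt_less)
  also have "\<dots> = (\<Sum>c | mwt c < D. \<Sum>(a, b)\<in>{(a, b). a + b = c}. coeff f a * coeff g b * coeff (eval_mono \<rho> c) m)"
    by (intro sum.cong) auto
  also have "\<dots> = coeff (subst \<rho> (f * g)) m"
    by (simp add: coeff_subst[OF assms, of m D] D_def coeff_mult sum_distrib_right case_prod_beta)
  finally show "coeff (subst \<rho> (f * g)) m = coeff (subst \<rho> f * subst \<rho> g) m" ..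
qed

lemma subst_power: "weight_raising \<rho> \<Longrightarrow> subst \<rho> (f ^ n) = subst \<rho> f ^ n"
  by (induction n) (auto simp: subst_mult)

lemma subst_prod: "weight_raising \<rho> \<Longrightarrow> subst \<rho> (prod F A) = (\<Prod>i\<in>A. subst \<rho> (F i))"
  by (induction A rule: infinite_finite_induct) (auto simp: subst_mult)

lemma subst_hsum:
  assumes "weight_raising \<rho>" "hsum X s"
  shows "hsum (\<lambda>n. subst \<rho> (X n)) (subst \<rho> s)"
  unfolding hsum_def
proof
  fix D
  show "subst \<rho> s - (\<Sum>n<D. subst \<rho> (X n)) \<in> ord_ge D"
    using subst_ord_ge[OF assms(1) hsumD[OF assms(2), of D]] by (simp add: subst_diff subst_sum)
qed

lemma subst_subst:
  assumes "weight_raising \<rho>" "weight_raising \<sigma>"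
  shows "subst \<rho> (subst \<sigma> f) = subst (\<lambda>v. subst \<rho> (\<sigma> v)) f"
proof (rule eq_if_ord_ge)
  fix D
  let ?\<rho>\<sigma> = "\<lambda>v. subst \<rho> (\<sigma> v)"
  have wr: "weight_raising ?\<rho>\<sigma>"
    using assms(2) subst_ord_ge[OF assms(1)] by (simp add: weight_raising_def)
  have "subst \<rho> (eval_mono \<sigma> a) = eval_mono ?\<rho>\<sigma> a" for a
    by (simp add: eval_mono_def subst_prod subst_power assms)
  then have "subst \<rho> (subst \<sigma> f) - (\<Sum>a | mwt a < D. const (coeff f a) * eval_mono ?\<rho>\<sigma> a) \<in> ord_ge D"
    using subst_ord_ge[OF assms(1) subst_truncate[OF assms(2)], of f D] assms
    by (simp add: subst_diff subst_sum subst_mult)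
  from ord_ge_diff[OF this subst_truncate[OF wr, of f D]]
  show "subst \<rho> (subst \<sigma> f) - subst ?\<rho>\<sigma> f \<in> ord_ge D"
    by simp
qed

definition monom :: "'v mono \<Rightarrow> 'v::weighted ps" where
  "monom a = Ps (\<lambda>m. if m = a then 1 else 0)"

lemma coeff_monom: "coeff (monom a) m = (if m = a then 1 else 0)"
  by (simp add: monom_def)

lemma coeff_monom_mult: "coeff (monom a * f) (a + m) = coeff f m"
proof -
  have "coeff (monom a * f) (a + m) = (\<Sum>(b, c)\<in>{(a, m)}. coeff (monom a) b * coeff f c)"
    unfolding coeff_mult
    by (rule sum.mono_neutral_right) (auto simp: finite_splits coeff_monom split: if_splits)
  then show ?thesis
    by (simp add: coeff_monom)
qed

lemma coeff_monom_mult_0: "(\<And>b. m \<noteq> a + b) \<Longrightarrow> coeff (monom a * f) m = 0"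
  unfolding coeff_mult by (rule sum.neutral) (auto simp: coeff_monom)

lemma monom_mult: "monom a * monom b = monom (a + b)"
proof (rule ps_eqI)
  fix m
  show "coeff (monom a * monom b) m = coeff (monom (a + b)) m"
  proof (cases "\<exists>c. m = a + c")
    case True
    then show ?thesis by (auto simp: coeff_monom_mult coeff_monom)
  next
    case False
    then show ?thesis by (subst coeff_monom_mult_0) (auto simp: coeff_monom)
  qed
qed

lemma subst_monom:
  assumes "weight_raising \<rho>"
  shows "subst \<rho> (monom a) = eval_mono \<rho> a"
proof (rule ps_eqI)
  fix m
  have "coeff (subst \<rho> (monom a)) m
      = (\<Sum>b | mwt b < Suc (max (mwt a) (mwt m)). coeff (monom a) b * coeff (eval_mono \<rho> b) m)"
    by (rule coeff_subst) (auto simp: assms)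
  also have "\<dots> = (\<Sum>b\<in>{a}. coeff (monom a) b * coeff (eval_mono \<rho> b) m)"
    by (rule sum.mono_neutral_right) (auto simp: finite_mwt_less coeff_monom)
  finally show "coeff (subst \<rho> (monom a)) m = coeff (eval_mono \<rho> a) m"
    by (simp add: coeff_monom)
qed

definition pvar :: "'v \<Rightarrow> 'v::weighted ps" where
  "pvar v = monom (Poly_Mapping.single v 1)"

lemma subst_pvar: "weight_raising \<rho> \<Longrightarrow> subst \<rho> (pvar v) = \<rho> v"
  by (simp add: pvar_def subst_monom)

lemma pvar_power: "pvar v ^ n = monom (Poly_Mapping.single v n)"
proof (induction n)
  case 0
  show ?case by (auto intro!: ps_eqI simp: coeff_one coeff_monom)
next
  case (Suc n)
  then show ?case
    by (simp add: pvar_def monom_mult flip: single_add)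
qed

lemma pvar_ord_ge: "pvar v \<in> ord_ge (wt v)"
  by (auto simp: ord_ge_def pvar_def coeff_monom)

lemma pvar_ord_ge_1: "pvar v \<in> ord_ge 1"
  using ord_ge_mono[OF pvar_ord_ge, of 1 v] wt_pos[of v] by simp

section \<open>Expansion in one variable and exponentials\<close>

definition cvar :: "'v \<Rightarrow> nat \<Rightarrow> 'v::weighted ps \<Rightarrow> 'v ps" where
  "cvar z n f = Ps (ps_coeff_var z n (coeff f))"

lemma coeff_cvar:
  "coeff (cvar z n f) m = (if Poly_Mapping.lookup m z = 0 then coeff f (m + Poly_Mapping.single z n) else 0)"
  by (simp add: cvar_def ps_coeff_var_def)

definition free_of :: "'v \<Rightarrow> 'v::weighted ps \<Rightarrow> bool" where
  "free_of z f \<longleftrightarrow> (\<forall>m. Poly_Mapping.lookup m z \<noteq> 0 \<longrightarrow> coeff f m = 0)"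

lemma free_of_cvar [simp]: "free_of z (cvar z n f)"
  by (simp add: free_of_def coeff_cvar)

lemma split_off_var:
  fixes m :: "'v mono"
  obtains m' where "m' + Poly_Mapping.single z (Poly_Mapping.lookup m z) = m" "Poly_Mapping.lookup m' z = 0"
proof
  define m' where "m' = m - Poly_Mapping.single z (Poly_Mapping.lookup m z)"
  show "m' + Poly_Mapping.single z (Poly_Mapping.lookup m z) = m"
    by (rule poly_mapping_eqI) (auto simp: m'_def lookup_add lookup_minus lookup_single when_def)
  show "Poly_Mapping.lookup m' z = 0"
    by (simp add: m'_def lookup_minus)
qed

lemma cvar_add: "cvar z n (f + g) = cvar z n f + cvar z n g"
  and cvar_zero [simp]: "cvar z n 0 = 0"
  by (auto intro!: ps_eqI simp: coeff_cvar)

lemma cvar_sum: "cvar z n (sum F A) = (\<Sum>i\<in>A. cvar z n (F i))"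
  by (induction A rule: infinite_finite_induct) (auto simp: cvar_add)

text \<open>If \<open>m\<close> is free of \<open>z\<close>, splitting m z^n amounts to splitting
  \<open>m\<close> and choosing the exponent \<open>i\<close> of \<open>z\<close> in the first
  factor.\<close>

lemma cvar_mult: "cvar z n (f * g) = (\<Sum>i\<le>n. cvar z i f * cvar z (n - i) g)"
proof (rule ps_eqI)
  fix m :: "'a mono"
  let ?s = "Poly_Mapping.single z"
  show "coeff (cvar z n (f * g)) m = coeff (\<Sum>i\<le>n. cvar z i f * cvar z (n - i) g) m"
  proof (cases "Poly_Mapping.lookup m z = 0")
    case False
    have "coeff (cvar z i f) a = 0 \<or> coeff (cvar z j g) b = 0" if "a + b = m" for a b i j
      using False that by (auto simp: coeff_cvar lookup_add)
    then show ?thesis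
      using False by (auto simp: coeff_cvar coeff_mult intro!: sum.neutral)
  next
    case True
    have "coeff (\<Sum>i\<le>n. cvar z i f * cvar z (n - i) g) m
       = (\<Sum>(i, (a, b))\<in>{..n} \<times> {(a, b). a + b = m}. coeff (cvar z i f) a * coeff (cvar z (n - i) g) b)"
      by (simp add: coeff_mult sum.cartesian_product)
    also have "\<dots> = (\<Sum>(a, b)\<in>{(a, b). a + b = m + ?s n}. coeff f a * coeff g b)"
    proof (rule sum.reindex_bij_witness[of _
          "\<lambda>(a, b). (Poly_Mapping.lookup a z, (a - ?s (Poly_Mapping.lookup a z), b - ?s (Poly_Mapping.lookup b z)))"
          "\<lambda>(i, (a, b)). (a + ?s i, b + ?s (n - i))"])
      fix p assume p: "p \<in> {..n} \<times> {(a, b). a + b = m}"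
      obtain i a b where [simp]: "p = (i, (a, b))" by (cases p) auto
      have m: "a + b = m" and i: "i \<le> n" using p by auto
      have ab: "Poly_Mapping.lookup a z = 0" "Poly_Mapping.lookup b z = 0"
        using True by (auto simp: m[symmetric] lookup_add)
      show "(case case p of (i, a, b) \<Rightarrow> (a + ?s i, b + ?s (n - i)) of (a, b) \<Rightarrow>
         (Poly_Mapping.lookup a z, (a - ?s (Poly_Mapping.lookup a z), b - ?s (Poly_Mapping.lookup b z)))) = p"
        by (simp add: ab lookup_add)
      have "a + ?s i + (b + ?s (n - i)) = (a + b) + (?s i + ?s (n - i))"
        by (simp only: ac_simps)
      also have "?s i + ?s (n - i) = ?s n"
        using i by (simp flip: single_add)
      finally show "(case p of (i, a, b) \<Rightarrow> (a + ?s i, b + ?s (n - i))) \<in> {(a, b). a + b = m + ?s n}"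
        by (simp add: m)
      show "(case (case p of (i, a, b) \<Rightarrow> (a + ?s i, b + ?s (n - i))) of (a, b) \<Rightarrow> coeff f a * coeff g b)
         = (case p of (i, a, b) \<Rightarrow> coeff (cvar z i f) a * coeff (cvar z (n - i) g) b)"
        by (simp add: coeff_cvar ab)
    next
      fix p assume p: "p \<in> {(a, b). a + b = m + ?s n}"
      obtain a b where [simp]: "p = (a, b)" by (cases p)
      obtain a' where a': "a' + ?s (Poly_Mapping.lookup a z) = a" "Poly_Mapping.lookup a' z = 0"
        by (rule split_off_var[of z a])
      obtain b' where b': "b' + ?s (Poly_Mapping.lookup b z) = b" "Poly_Mapping.lookup b' z = 0"
        by (rule split_off_var[of z b])
      have eq: "a + b = m + ?s n" using p by simp
      have n: "Poly_Mapping.lookup a z + Poly_Mapping.lookup b z = n"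
        using arg_cong[OF eq, of "\<lambda>x. Poly_Mapping.lookup x z"] True by (simp add: lookup_add)
      have da: "a - ?s (Poly_Mapping.lookup a z) = a'" and db: "b - ?s (Poly_Mapping.lookup b z) = b'"
        by (metis a'(1) add_diff_cancel_right', metis b'(1) add_diff_cancel_right')
      have "(a' + b') + ?s n = a + b"
        by (subst a'(1)[symmetric], subst b'(1)[symmetric]) (simp add: n[symmetric] single_add ac_simps)
      then have "a' + b' = m"
        using eq by simp
      then show "(case p of (a, b) \<Rightarrow>
         (Poly_Mapping.lookup a z, (a - ?s (Poly_Mapping.lookup a z), b - ?s (Poly_Mapping.lookup b z))))
          \<in> {..n} \<times> {(a, b). a + b = m}"
        using n by (auto simp: da db)
      have "n - Poly_Mapping.lookup a z = Poly_Mapping.lookup b z"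
        using n by simp
      then show "(case case p of (a, b) \<Rightarrow>
         (Poly_Mapping.lookup a z, (a - ?s (Poly_Mapping.lookup a z), b - ?s (Poly_Mapping.lookup b z)))
          of (i, a, b) \<Rightarrow> (a + ?s i, b + ?s (n - i))) = p"
        by (simp add: da db a'(1) b'(1))
    qed
    finally show ?thesis
      using True by (simp add: coeff_cvar coeff_mult)
  qed
qed

lemma cvar_pvar_power_mult:
  assumes "free_of z f"
  shows "cvar z n (pvar z ^ j * f) = (if n = j then f else 0)"
proof (rule ps_eqI)
  fix m
  let ?s = "Poly_Mapping.single z"
  show "coeff (cvar z n (pvar z ^ j * f)) m = coeff (if n = j then f else 0) m"
  proof (cases "Poly_Mapping.lookup m z = 0")
    case False
    then show ?thesis using assms by (simp add: coeff_cvar free_of_def)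
  next
    case True
    show ?thesis
    proof (cases "\<exists>b. m + ?s n = ?s j + b")
      case ex: True
      then obtain b where b: "m + ?s n = ?s j + b" by blast
      have 1: "coeff (cvar z n (pvar z ^ j * f)) m = coeff f b"
        by (simp only: coeff_cvar pvar_power b coeff_monom_mult True if_True refl)
      have 2: "n = j + Poly_Mapping.lookup b z"
        using arg_cong[OF b, of "\<lambda>x. Poly_Mapping.lookup x z"] True by (simp add: lookup_add)
      show ?thesis
      proof (cases "n = j")
        case True
        then have "b = m" using b by (simp add: add.commute)
        with True 1 show ?thesis by simp
      next
        case False
        with 2 have "Poly_Mapping.lookup b z \<noteq> 0" by simp
        with False 1 assms show ?thesis by (simp add: free_of_def)
      qed
    next
      case False
      then have "n \<noteq> j" by (auto simp: add.commute)
      with False True show ?thesis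
        by (simp add: coeff_cvar pvar_power coeff_monom_mult_0)
    qed
  qed
qed

text \<open>The exponent of \<open>z\<close> in a monomial is at most its weight, so the first
  \<open>D\<close> terms of the expansion account for all weights below \<open>D\<close>.\<close>

lemma hsum_cvar:
  "hsum (\<lambda>n. pvar z ^ n * cvar z n f) f"
  unfolding hsum_def
proof
  fix D
  have "coeff f m = coeff (\<Sum>n<D. pvar z ^ n * cvar z n f) m" if "mwt m < D" for m
  proof -
    obtain m' where m': "m' + Poly_Mapping.single z (Poly_Mapping.lookup m z) = m" "Poly_Mapping.lookup m' z = 0"
      by (rule split_off_var[of z m])
    define k where "k = Poly_Mapping.lookup m z"
    have "k < D" using lookup_le_mwt'[of m z] that by (simp add: k_def)
    have "coeff (\<Sum>n<D. pvar z ^ n * cvar z n f) m = coeff (cvar z k (\<Sum>n<D. pvar z ^ n * cvar z n f)) m'"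
      using m' by (simp add: coeff_cvar k_def)
    also have "\<dots> = coeff (cvar z k f) m'"
      using \<open>k < D\<close> by (simp add: cvar_sum cvar_pvar_power_mult if_distrib[of "\<lambda>g. coeff g _"] cong: if_cong)
    also have "\<dots> = coeff f m"
      using m' by (simp add: coeff_cvar k_def)
    finally show ?thesis ..
  qed
  then show "f - (\<Sum>n<D. pvar z ^ n * cvar z n f) \<in> ord_ge D"
    by (simp add: ord_ge_def)
qed

lemma hsum_subst_cvar:
  assumes "weight_raising \<rho>"
  shows "hsum (\<lambda>n. \<rho> z ^ n * subst \<rho> (cvar z n f)) (subst \<rho> f)"
  using subst_hsum[OF assms hsum_cvar[of z f]] assms
  by (simp add: subst_mult subst_power subst_pvar)

lemma subst_cong_free:
  assumes "free_of z f" "\<And>v. v \<noteq> z \<Longrightarrow> \<rho> v = \<sigma> v"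
  shows "subst \<rho> f = subst \<sigma> f"
proof -
  have "eval_mono \<rho> a = eval_mono \<sigma> a" if "coeff f a \<noteq> 0" for a
  proof -
    have "Poly_Mapping.lookup a z = 0"
      using assms(1) that by (auto simp: free_of_def)
    then show ?thesis
      unfolding eval_mono_def using assms(2) by (intro prod.cong refl) (metis in_keys_iff)
  qed
  then have *: "coeff f a * coeff (eval_mono \<rho> a) m = coeff f a * coeff (eval_mono \<sigma> a) m" for a m
    by (cases "coeff f a = 0") auto
  show ?thesis
    unfolding subst_def * ..
qed

section \<open>The differential equation of an exponential series\<close>

definition vfps :: "'v \<Rightarrow> 'v::weighted ps \<Rightarrow> 'v ps fps" where
  "vfps z f = Abs_fps (\<lambda>n. cvar z n f)"

lemma vfps_mult: "vfps z (f * g) = vfps z f * vfps z g"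
  by (rule fps_ext) (simp add: vfps_def fps_mult_nth cvar_mult atLeast0AtMost)

text \<open>This is z d/dz. It preserves the weight, whereas d/dz would lower it, and can therefore
  be applied to a convergent series term by term.\<close>

definition euler :: "'v \<Rightarrow> 'v::weighted ps \<Rightarrow> 'v ps" where
  "euler z f = Ps (\<lambda>m. of_nat (Poly_Mapping.lookup m z) * coeff f m)"

lemma coeff_euler [simp]: "coeff (euler z f) m = of_nat (Poly_Mapping.lookup m z) * coeff f m"
  by (simp add: euler_def)

lemma euler_diff: "euler z (f - g) = euler z f - euler z g"
  and euler_zero [simp]: "euler z 0 = 0"
  and euler_one [simp]: "euler z 1 = 0"
  and euler_add: "euler z (f + g) = euler z f + euler z g"
  by (auto intro!: ps_eqI simp: algebra_simps coeff_one)

lemma euler_const_mult: "euler z (const c * f) = const c * euler z f"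
  by (rule ps_eqI) simp

lemma euler_sum: "euler z (sum F A) = (\<Sum>i\<in>A. euler z (F i))"
  by (induction A rule: infinite_finite_induct) (auto simp: euler_add)

lemma euler_ord_ge: "f \<in> ord_ge n \<Longrightarrow> euler z f \<in> ord_ge n"
  by (simp add: ord_ge_def)

lemma euler_mult: "euler z (f * g) = euler z f * g + f * euler z g"
proof (rule ps_eqI)
  fix m
  show "coeff (euler z (f * g)) m = coeff (euler z f * g + f * euler z g) m"
    unfolding coeff_add coeff_euler coeff_mult sum_distrib_left sum.distrib[symmetric]
    by (rule sum.cong) (auto simp: lookup_add algebra_simps)
qed

lemma euler_power: "euler z (f ^ Suc n) = of_nat (Suc n) * (euler z f * f ^ n)"
  by (induction n) (simp_all add: euler_mult algebra_simps)

lemma cvar_euler: "cvar z n (euler z f) = of_nat n * cvar z n f"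
  by (rule ps_eqI) (simp add: coeff_cvar lookup_add)

text \<open>The operator sends f^(n+1)/(n+1)! to f^n/n! times \<open>euler z f\<close> and
  annihilates the term n = 0. The cutoff \<open>Suc D\<close> absorbs this index shift.\<close>

lemma euler_exp:
  fixes f :: "'v::weighted ps"
  assumes "hsum (\<lambda>n. const (1 / fact n) * f ^ n) E"
  shows "euler z E = euler z f * E"
proof (rule eq_if_ord_ge)
  fix D
  have 1: "euler z (const (1 / fact (Suc n)) * f ^ Suc n) = euler z f * (const (1 / fact n) * f ^ n)" for n
  proof -
    have "const (1 / fact (Suc n)) * of_nat (Suc n) = (const (1 / fact n) :: 'v ps)"
      unfolding const_of_nat[symmetric] const_mult[symmetric] fact_Suc
      by (simp del: of_nat_Suc)
    then have "const (1 / fact (Suc n)) * (of_nat (Suc n) * x) = const (1 / fact n) * x" for x :: "'v ps"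
      by (simp only: mult.assoc[symmetric])
    from this[of "euler z f * f ^ n"] show ?thesis
      unfolding euler_const_mult euler_power by (simp only: mult.left_commute)
  qed
  have "euler z E - (\<Sum>n<Suc D. euler z (const (1 / fact n) * f ^ n)) \<in> ord_ge (Suc D)"
    using euler_ord_ge[OF hsumD[OF assms, of "Suc D"], of z] by (simp only: euler_diff euler_sum)
  then have "euler z E - (\<Sum>n<D. euler z f * (const (1 / fact n) * f ^ n)) \<in> ord_ge (Suc D)"
    unfolding sum.lessThan_Suc_shift 1 by simp
  then have "euler z E - (\<Sum>n<D. euler z f * (const (1 / fact n) * f ^ n)) \<in> ord_ge D"
    by (rule ord_ge_mono) simp
  from ord_ge_diff[OF this hsumD[OF hsum_mult_left[OF assms, of "euler z f"], of D]]
  show "euler z E - euler z f * E \<in> ord_ge D"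
    by simp
qed

text \<open>Under \<open>vfps\<close> the Euler operator becomes \<open>fps_X\<close> times the
  derivative; the factor \<open>fps_X\<close> is then cancelled by comparing the coefficients at
  \<open>Suc n\<close>.\<close>

lemma fps_deriv_vfps_exp:
  assumes "hsum (\<lambda>n. const (1 / fact n) * f ^ n) E"
  shows "fps_deriv (vfps z E) = fps_deriv (vfps z f) * vfps z E"
proof -
  have eu: "vfps z (euler z g) = fps_X * fps_deriv (vfps z g)" for g :: "'a ps"
  proof (rule fps_ext)
    fix n
    show "vfps z (euler z g) $ n = (fps_X * fps_deriv (vfps z g)) $ n"
      by (cases n) (simp_all add: vfps_def cvar_euler del: of_nat_Suc)
  qed
  have *: "fps_X * fps_deriv (vfps z E) = fps_X * (fps_deriv (vfps z f) * vfps z E)"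
    unfolding mult.assoc[symmetric] eu[symmetric] by (simp only: euler_exp[OF assms] vfps_mult)
  show ?thesis
  proof (rule fps_ext)
    fix n
    show "fps_deriv (vfps z E) $ n = (fps_deriv (vfps z f) * vfps z E) $ n"
      using arg_cong[OF *, of "\<lambda>h. h $ Suc n"] by (simp add: del: fps_deriv_nth)
  qed
qed

definition map_fps :: "('a \<Rightarrow> 'b) \<Rightarrow> 'a::zero fps \<Rightarrow> 'b::zero fps" where
  "map_fps h f = Abs_fps (\<lambda>n. h (f $ n))"

lemma map_fps_nth [simp]: "map_fps h f $ n = h (f $ n)"
  by (simp add: map_fps_def)

lemma map_fps_subst_mult:
  "weight_raising \<rho> \<Longrightarrow> map_fps (subst \<rho>) (f * g) = map_fps (subst \<rho>) f * map_fps (subst \<rho>) g"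
  by (rule fps_ext) (simp add: fps_mult_nth subst_sum subst_mult)

lemma map_fps_subst_deriv:
  "weight_raising \<rho> \<Longrightarrow> map_fps (subst \<rho>) (fps_deriv f) = fps_deriv (map_fps (subst \<rho>) f)"
  by (rule fps_ext) (simp add: subst_mult del: of_nat_Suc of_nat_add)

text \<open>The equation is a recursion expressing n + 1 times the next coefficient by the earlier
  ones, and positive integers can be cancelled over the complex numbers.\<close>

lemma fps_exp_ode_unique:
  fixes e e' :: "'v::weighted ps fps"
  assumes "fps_deriv e = q * e" "fps_deriv e' = q * e'" "e $ 0 = e' $ 0"
  shows "e = e'"
proof (rule fps_ext)
  fix n
  show "e $ n = e' $ n"
  proof (induction n rule: less_induct)
    case (less n)
    show ?case
    proof (cases n)
      case (Suc k)
      have "of_nat (Suc k) * e $ Suc k = (q * e) $ k"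
        by (simp flip: assms(1))
      also have "\<dots> = (q * e') $ k"
        unfolding fps_mult_nth by (rule sum.cong) (auto simp: less Suc)
      also have "\<dots> = of_nat (Suc k) * e' $ Suc k"
        by (simp flip: assms(2))
      finally show ?thesis
        unfolding Suc by (rule of_nat_mult_cancel_ps[rotated]) simp
    qed (use assms(3) in simp)
  qed
qed

section \<open>Passage from the definitions\<close>

instantiation tv :: weighted
begin

fun wt_tv :: "tv \<Rightarrow> nat" where
  "wt_tv (Tv k) = Suc k"
| "wt_tv (Tbv k) = Suc k"

instance
proof
  fix v :: tv and n
  show "wt v > 0" by (cases v) auto
  have "v \<in> Tv ` {..n} \<union> Tbv ` {..n}" if "wt v \<le> n" for v
    using that by (cases v) auto
  then have "{v :: tv. wt v \<le> n} \<subseteq> Tv ` {..n} \<union> Tbv ` {..n}"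
    by blast
  then show "finite {v :: tv. wt v \<le> n}"
    by (rule finite_subset) simp
qed

end

instantiation var :: weighted
begin

fun wt_var :: "var \<Rightarrow> nat" where
  "wt_var (P v) = wt v"
| "wt_var (Q v) = wt v"
| "wt_var Z = 1"
| "wt_var L = 1"
| "wt_var M = 1"

instance
proof
  fix v :: var and n
  show "wt v > 0" by (cases v) (auto simp: wt_pos)
  have "v \<in> P ` {v. wt v \<le> n} \<union> Q ` {v. wt v \<le> n} \<union> {Z, L, M}" if "wt v \<le> n" for v
    using that by (cases v) auto
  then have "{v :: var. wt v \<le> n} \<subseteq> P ` {v. wt v \<le> n} \<union> Q ` {v. wt v \<le> n} \<union> {Z, L, M}"
    by blast
  then show "finite {v :: var. wt v \<le> n}"
    by (rule finite_subset) (simp add: finite_wt_le)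
qed

end

definition of_mpoly :: "'v mpoly \<Rightarrow> 'v::weighted ps" where
  "of_mpoly p = Ps (ps_of_poly p)"

lemma coeff_of_mpoly [simp]: "coeff (of_mpoly p) m = Poly_Mapping.lookup p m"
  by (simp add: of_mpoly_def ps_of_poly_def)

lemma of_mpoly_add [simp]: "of_mpoly (p + q) = of_mpoly p + of_mpoly q"
  and of_mpoly_minus [simp]: "of_mpoly (- p) = - of_mpoly p"
  and of_mpoly_zero [simp]: "of_mpoly 0 = 0"
  and of_mpoly_one [simp]: "of_mpoly 1 = 1"
  by (auto intro!: ps_eqI simp: lookup_add lookup_one coeff_one)

lemma of_mpoly_diff [simp]: "of_mpoly (p - q) = of_mpoly p - of_mpoly q"
  using of_mpoly_add[of p "- q"] by simp

lemma of_mpoly_mult [simp]: "of_mpoly (p * q) = of_mpoly p * of_mpoly (q :: 'v::weighted mpoly)"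
proof (rule ps_eqI)
  fix m :: "'v mono"
  let ?g = "\<lambda>(a, b). Poly_Mapping.lookup p a * Poly_Mapping.lookup q b when m = a + b"
  have "Poly_Mapping.lookup (p * q) m = Sum_any ?g"
    by (simp add: times_poly_mapping.rep_eq prod_fun_unfold_prod)
  also have "\<dots> = (\<Sum>x\<in>{(a, b). a + b = m}. ?g x)"
    by (rule Sum_any.expand_superset) (auto simp: finite_splits)
  also have "\<dots> = coeff (of_mpoly p * of_mpoly q) m"
    unfolding coeff_mult by (rule sum.cong) auto
  finally show "coeff (of_mpoly (p * q)) m = coeff (of_mpoly p * of_mpoly q) m"
    by simp
qed

lemma of_mpoly_power [simp]: "of_mpoly (p ^ n) = of_mpoly p ^ n"
  by (induction n) auto

lemma of_mpoly_prod: "of_mpoly (prod F A) = (\<Prod>i\<in>A. of_mpoly (F i))"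
  by (induction A rule: infinite_finite_induct) auto

lemma of_mpoly_pVar [simp]: "of_mpoly (pVar v) = pvar v"
  by (rule ps_eqI) (auto simp: pVar_def pvar_def coeff_monom lookup_single when_def)

lemma of_mpoly_pConst [simp]: "of_mpoly (pConst c) = const c"
  by (rule ps_eqI) (auto simp: pConst_def coeff_const lookup_single when_def)

lemma Ps_add: "Ps (ps_add f g) = Ps f + Ps g"
  and Ps_diff: "Ps (ps_diff f g) = Ps f - Ps g"
  and Ps_mult: "Ps (ps_mult f g) = Ps f * Ps g"
  by (simp_all add: plus_ps_def minus_ps_def times_ps_def)

lemma Ps_pmult: "Ps (ps_pmult p f) = of_mpoly p * Ps f"
  by (simp add: Ps_mult of_mpoly_def ps_pmult_def)

lemma Ps_pow: "Ps (ps_pow f n) = Ps f ^ n"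
  by (induction n) (simp_all add: Ps_mult one_ps_def)

text \<open>Monomials heavier than \<open>m\<close> contribute 0, so the infinite sum in
  \<open>ps_subst\<close> collapses to the finite one that defines \<open>subst\<close>.\<close>

lemma Ps_subst:
  assumes "weight_raising (\<lambda>v. of_mpoly (\<sigma> v))"
  shows "Ps (ps_subst \<sigma> f) = subst (\<lambda>v. of_mpoly (\<sigma> v)) (Ps f)"
proof (rule ps_eqI)
  fix m
  let ?c = "\<lambda>a. Poly_Mapping.lookup (\<Prod>v\<in>Poly_Mapping.keys a. \<sigma> v ^ Poly_Mapping.lookup a v) m"
  have c: "?c a = coeff (eval_mono (\<lambda>v. of_mpoly (\<sigma> v)) a) m" for a
    unfolding coeff_of_mpoly[symmetric] by (simp add: of_mpoly_prod eval_mono_def del: coeff_of_mpoly)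
  have "?c a = 0" if "\<not> mwt a \<le> mwt m" for a
    unfolding c using that by (intro ord_geD[OF eval_mono_ord_ge[OF assms]]) simp
  then have "ps_subst \<sigma> f m = (\<Sum>\<^sub>\<infinity>a\<in>{a. mwt a \<le> mwt m}. f a * ?c a)"
    unfolding ps_subst_def ps_infsum_def by (intro infsum_cong_neutral) auto
  also have "\<dots> = (\<Sum>a | mwt a \<le> mwt m. f a * ?c a)"
    by (intro infsum_finite finite_mwt_le)
  finally show "coeff (Ps (ps_subst \<sigma> f)) m = coeff (subst (\<lambda>v. of_mpoly (\<sigma> v)) (Ps f)) m"
    by (simp add: c subst_def)
qed

text \<open>The Miwa vector is taken at an arbitrary series because the spectral variable will be
  replaced by 0 and by the parameters.\<close>

definition mw :: "'v::weighted ps \<Rightarrow> nat \<Rightarrow> 'v ps" where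
  "mw u k = const (1 / of_nat (Suc k)) * u ^ Suc k"

lemma of_mpoly_miwa [simp]: "of_mpoly (miwa u k) = mw (pvar u) k"
  unfolding miwa_def mw_def by (simp only: of_mpoly_mult of_mpoly_power of_mpoly_pVar of_mpoly_pConst)

lemma mw_ord_ge: "u \<in> ord_ge 1 \<Longrightarrow> mw u k \<in> ord_ge (Suc k)"
  using ord_ge_power[of u 1 "Suc k"] unfolding mw_def by (auto intro: ord_ge_mult_left)

lemma mw_zero [simp]: "mw 0 = (\<lambda>k. 0)"
  by (simp add: mw_def fun_eq_iff)

lemma subst_mw: "weight_raising \<rho> \<Longrightarrow> subst \<rho> (mw u k) = mw (subst \<rho> u) k"
  unfolding mw_def by (simp only: subst_mult subst_const subst_power)

lemma of_nat_mw: "of_nat (Suc k) * mw u k = u ^ Suc k"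
proof -
  have "of_nat (Suc k) * const (1 / of_nat (Suc k)) = (1 :: 'a ps)"
    unfolding const_of_nat[symmetric] const_mult[symmetric] by (simp del: of_nat_Suc)
  then show ?thesis
    unfolding mw_def mult.assoc[symmetric] by simp
qed

text \<open>Exactly the order that t_(k+1) has itself; with such shifts \<open>shift_vars\<close> is
  weight raising.\<close>

definition graded :: "(nat \<Rightarrow> 'v::weighted ps) \<Rightarrow> bool" where
  "graded a \<longleftrightarrow> (\<forall>k. a k \<in> ord_ge (Suc k))"

lemma graded_mw [intro]: "u \<in> ord_ge 1 \<Longrightarrow> graded (mw u)"
  and graded_zero [intro]: "graded (\<lambda>k. 0)"
  and graded_add [intro]: "graded a \<Longrightarrow> graded b \<Longrightarrow> graded (\<lambda>k. a k + b k)"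
  and graded_minus [intro]: "graded a \<Longrightarrow> graded (\<lambda>k. - a k)"
  by (auto simp: graded_def mw_ord_ge intro: ord_ge_add ord_ge_diff ord_ge_minus)

definition shift_vars :: "(tv \<Rightarrow> var) \<Rightarrow> (nat \<Rightarrow> var ps) \<Rightarrow> (nat \<Rightarrow> var ps) \<Rightarrow> tv \<Rightarrow> var ps" where
  "shift_vars base a b v = pvar (base v) + (case v of Tv k \<Rightarrow> a k | Tbv k \<Rightarrow> b k)"

definition shifted :: "tv mps \<Rightarrow> (tv \<Rightarrow> var) \<Rightarrow> (nat \<Rightarrow> var ps) \<Rightarrow> (nat \<Rightarrow> var ps) \<Rightarrow> var ps" where
  "shifted f base a b = subst (shift_vars base a b) (Ps f)"

lemma weight_raising_shift_vars:
  assumes "\<And>v. wt (base v) = wt v" "graded a" "graded b"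
  shows "weight_raising (shift_vars base a b)"
proof -
  have "pvar (base v) \<in> ord_ge (wt v)" for v
    using pvar_ord_ge[of "base v"] by (simp add: assms)
  moreover have "(case v of Tv k \<Rightarrow> a k | Tbv k \<Rightarrow> b k) \<in> ord_ge (wt v)" for v
    using assms(2,3) by (cases v) (simp_all add: graded_def)
  ultimately show ?thesis
    by (simp add: weight_raising_def shift_vars_def ord_ge_add)
qed

lemma Ps_tau_at:
  assumes "\<And>v. wt (base v) = wt v" "graded (\<lambda>k. of_mpoly (a k))" "graded (\<lambda>k. of_mpoly (b k))"
  shows "Ps (tau_at f base a b) = shifted f base (\<lambda>k. of_mpoly (a k)) (\<lambda>k. of_mpoly (b k))"
proof -
  have *: "(\<lambda>v. of_mpoly (pVar (base v) + (case v of Tv k \<Rightarrow> a k | Tbv k \<Rightarrow> b k)))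
    = shift_vars base (\<lambda>k. of_mpoly (a k)) (\<lambda>k. of_mpoly (b k))"
    by (auto simp: shift_vars_def fun_eq_iff split: tv.split)
  show ?thesis
    unfolding tau_at_def shifted_def *[symmetric]
    by (rule Ps_subst) (simp only: * weight_raising_shift_vars[OF assms])
qed

text \<open>\<open>e(z) = exp (\<Sum>k. a\<^sub>k z\<^sup>k\<^sup>+\<^sup>1)\<close>, characterised by its differential equation so that no
  infinite sum has to be carried through substitutions.\<close>
definition is_exp :: "(nat \<Rightarrow> 'v::weighted ps) \<Rightarrow> 'v ps fps \<Rightarrow> bool" where
  "is_exp a e \<longleftrightarrow> e $ 0 = 1 \<and> fps_deriv e = Abs_fps (\<lambda>k. of_nat (Suc k) * a k) * e"

lemma is_exp_unique: "is_exp a e \<Longrightarrow> is_exp a e' \<Longrightarrow> e = e'"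
  unfolding is_exp_def by (rule fps_exp_ode_unique) auto

lemma is_exp_zero: "is_exp (\<lambda>k. 0) 1"
  by (simp add: is_exp_def fps_zero_def[symmetric])

lemma is_exp_add:
  assumes "is_exp a e" "is_exp b f"
  shows "is_exp (\<lambda>k. a k + b k) (e * f)"
proof -
  have "Abs_fps (\<lambda>k. of_nat (Suc k) * (a k + b k))
      = Abs_fps (\<lambda>k. of_nat (Suc k) * a k) + Abs_fps (\<lambda>k. of_nat (Suc k) * b k)"
    by (rule fps_ext) (simp add: distrib_left)
  then show ?thesis
    using assms by (simp add: is_exp_def algebra_simps del: of_nat_Suc)
qed

definition geom :: "'v::weighted ps \<Rightarrow> 'v ps fps" where
  "geom u = Abs_fps (\<lambda>n. u ^ n)"

lemma geom_nth [simp]: "geom u $ n = u ^ n"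
  by (simp add: geom_def)

text \<open>The exponent is the series of - log (1 - u z), so its exponential is 1 / (1 - u z). In
  the differential equation, coefficient \<open>n\<close> on the right consists of n + 1 equal
  summands.\<close>

lemma is_exp_mw: "is_exp (mw u) (geom u)"
proof -
  have "fps_deriv (geom u) = Abs_fps (\<lambda>k. u ^ Suc k) * geom u"
  proof (rule fps_ext)
    fix n
    have "(Abs_fps (\<lambda>k. u ^ Suc k) * geom u) $ n = (\<Sum>i=0..n. u ^ Suc n)"
      unfolding fps_mult_nth by (rule sum.cong) (auto simp: mult.assoc simp flip: power_add)
    then show "fps_deriv (geom u) $ n = (Abs_fps (\<lambda>k. u ^ Suc k) * geom u) $ n"
      by simp
  qed
  then show ?thesis
    by (simp add: is_exp_def of_nat_mw del: of_nat_Suc power_Suc)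
qed

lemma is_exp_minus_mw: "is_exp (\<lambda>k. - mw u k) (1 - fps_const u * fps_X)"
proof -
  let ?g = "1 - fps_const u * fps_X"
  have g: "Abs_fps (\<lambda>k. u ^ Suc k) * ?g = fps_const u"
  proof (rule fps_ext)
    fix n
    have "Abs_fps (\<lambda>k. u ^ Suc k) * ?g
        = Abs_fps (\<lambda>k. u ^ Suc k) - fps_const u * (Abs_fps (\<lambda>k. u ^ Suc k) * fps_X)"
      by (simp add: algebra_simps)
    then show "(Abs_fps (\<lambda>k. u ^ Suc k) * ?g) $ n = fps_const u $ n"
      by (cases n) simp_all
  qed
  have "Abs_fps (\<lambda>k. of_nat (Suc k) * - mw u k) = - Abs_fps (\<lambda>k. u ^ Suc k)"
    by (rule fps_ext) (simp add: of_nat_mw del: of_nat_Suc power_Suc)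
  then have "Abs_fps (\<lambda>k. of_nat (Suc k) * - mw u k) * ?g = - fps_const u"
    by (simp only: mult_minus_left g)
  moreover have "fps_deriv ?g = - fps_const u"
    by simp
  ultimately show ?thesis
    by (simp add: is_exp_def del: of_nat_Suc)
qed

text \<open>Induction along the recursion contained in the differential equation. These orders make
  the residue sums converge.\<close>

lemma is_exp_ord_ge:
  assumes "is_exp a e" "graded a"
  shows "e $ n \<in> ord_ge n"
proof (induction n rule: less_induct)
  case (less n)
  show ?case
  proof (cases n)
    case (Suc k)
    have "of_nat (Suc k) * e $ Suc k = fps_deriv e $ k"
      by simp
    also have "\<dots> = (\<Sum>i=0..k. of_nat (Suc i) * a i * e $ (k - i))"
      using assms(1) by (simp add: is_exp_def fps_mult_nth del: fps_deriv_nth)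
    also have "\<dots> \<in> ord_ge (Suc k)"
    proof (rule ord_ge_sum)
      fix i assume i: "i \<in> {0..k}"
      have "of_nat (Suc i) * a i * e $ (k - i) \<in> ord_ge (Suc i + (k - i))"
        using i assms(2) Suc by (intro ord_ge_mult ord_ge_mult_left less) (auto simp: graded_def)
      then show "of_nat (Suc i) * a i * e $ (k - i) \<in> ord_ge (Suc k)"
        using i by simp
    qed
    finally have "of_nat (Suc k) * e $ Suc k \<in> ord_ge (Suc k)" .
    then show ?thesis
      unfolding Suc ord_ge_def by (auto simp del: of_nat_Suc)
  qed simp
qed

text \<open>Connects the exponential of the bilinear equation with its differential equation. As
  each \<open>d k\<close> is free of \<open>z\<close>, it is the full coefficient of z^(k+1) in the
  exponent.\<close>

lemma is_exp_exp_xi: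
  assumes "graded (\<lambda>k. of_mpoly (d k))" "\<And>k. free_of z (of_mpoly (d k))"
  shows "is_exp (\<lambda>k. of_mpoly (d k)) (vfps z (Ps (exp_xi d z)))"
proof -
  let ?X = "\<lambda>k. ps_of_poly (d k * pVar z ^ Suc k)"
  define f where "f = Ps (ps_infsum ?X)"
  define E where "E = Ps (exp_xi d z)"
  have PsX: "Ps (?X k) = pvar z ^ Suc k * of_mpoly (d k)" for k
    unfolding of_mpoly_def[symmetric] of_mpoly_mult of_mpoly_power of_mpoly_pVar by (rule mult.commute)
  \<comment> \<open>The first bound makes the exponent converge; the second gives it positive order,
    so that its powers over factorials converge as well.\<close>
  have X: "Ps (?X k) \<in> ord_ge k" "Ps (?X k) \<in> ord_ge 1" for k
    using assms(1) unfolding PsX graded_def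
    by (auto intro!: ord_ge_mult_left intro: ord_ge_mono[of _ "Suc k"])
  have hf: "hsum (\<lambda>k. Ps (?X k)) f"
    unfolding f_def by (rule hsum_infsum[OF X(1)])
  have "f - Ps (?X 0) \<in> ord_ge 1"
    using hsumD[OF hf, of 1] by simp
  from ord_ge_add[OF this X(2)[of 0]] have f1: "f \<in> ord_ge 1"
    by simp
  have cf: "cvar z n f = (case n of 0 \<Rightarrow> 0 | Suc k \<Rightarrow> of_mpoly (d k))" for n
  proof (rule ps_eqI)
    fix m
    show "coeff (cvar z n f) m = coeff (case n of 0 \<Rightarrow> 0 | Suc k \<Rightarrow> of_mpoly (d k)) m"
    proof (cases "Poly_Mapping.lookup m z = 0")
      case True
      \<comment> \<open>Below this bound a finite partial sum computes the coefficient, and since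
        \<open>n < D\<close> it contains the only surviving term, at k = n - 1.\<close>
      define D where "D = Suc (mwt (m + Poly_Mapping.single z n))"
      have "wt z * n \<ge> n" using wt_pos[of z] by simp
      then have D: "n < D" by (simp only: D_def mwt_plus mwt_single less_Suc_eq_le trans_le_add2)
      have "coeff (cvar z n f) m = coeff f (m + Poly_Mapping.single z n)"
        using True by (simp add: coeff_cvar)
      also have "\<dots> = (\<Sum>k<D. coeff (Ps (?X k)) (m + Poly_Mapping.single z n))"
        by (rule hsum_coeff[OF hf]) (simp add: D_def)
      also have "\<dots> = (\<Sum>k<D. coeff (cvar z n (Ps (?X k))) m)"
        using True by (simp add: coeff_cvar)
      also have "\<dots> = (\<Sum>k<D. coeff (if n = Suc k then of_mpoly (d k) else 0) m)"
        unfolding PsX by (simp only: cvar_pvar_power_mult[OF assms(2)])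
      also have "\<dots> = coeff (case n of 0 \<Rightarrow> 0 | Suc k \<Rightarrow> of_mpoly (d k)) m"
      proof (cases n)
        case (Suc j)
        then have "(\<Sum>k<D. coeff (if n = Suc k then of_mpoly (d k) else 0) m)
            = (\<Sum>k<D. if k = j then coeff (of_mpoly (d k)) m else 0)"
          by (intro sum.cong) auto
        then show ?thesis using Suc D by simp
      qed simp
      finally show ?thesis .
    next
      case False
      then show ?thesis
        using assms(2) by (auto simp: coeff_cvar free_of_def split: nat.split)
    qed
  qed
  have PsE: "Ps (\<lambda>m. ps_pow (ps_infsum ?X) n m / of_nat (fact n)) = const (1 / fact n) * f ^ n" for n
    by (rule ps_eqI) (simp add: f_def flip: Ps_pow)
  have hE: "hsum (\<lambda>n. const (1 / fact n) * f ^ n) E"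
    unfolding E_def exp_xi_def ps_exp_def PsE[symmetric]
  proof (rule hsum_infsum)
    fix n
    show "Ps (\<lambda>m. ps_pow (ps_infsum ?X) n m / of_nat (fact n)) \<in> ord_ge n"
      unfolding PsE using ord_ge_power[OF f1, of n] by (simp add: ord_ge_mult_left)
  qed
  \<comment> \<open>The exponent has no term of degree 0 in \<open>z\<close>, so neither do its
    positive powers; this yields the initial value 1.\<close>
  have c0: "cvar z 0 (f ^ Suc n) = 0" for n
    using cf[of 0] by (simp add: cvar_mult)
  have "cvar z 0 E = 1"
  proof (rule ps_eqI)
    fix m
    show "coeff (cvar z 0 E) m = coeff 1 m"
    proof (cases "Poly_Mapping.lookup m z = 0")
      case True
      have "coeff (f ^ Suc n) m = 0" for n
        using arg_cong[OF c0[of n], of "\<lambda>g. coeff g m"] True by (simp add: coeff_cvar)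
      then have "(\<Sum>n<Suc (mwt m). coeff (const (1 / fact n) * f ^ n) m) = coeff 1 m"
        unfolding sum.lessThan_Suc_shift by simp
      then show ?thesis
        using True hsum_coeff[OF hE, of m "Suc (mwt m)"] by (simp add: coeff_cvar)
    next
      case False
      then show ?thesis by (auto simp: coeff_cvar coeff_one)
    qed
  qed
  moreover have "fps_deriv (vfps z f) = Abs_fps (\<lambda>k. of_nat (Suc k) * of_mpoly (d k))"
    by (rule fps_ext) (simp add: vfps_def cf)
  ultimately show ?thesis
    using fps_deriv_vfps_exp[OF hE, of z] by (simp add: is_exp_def E_def vfps_def)
qed

lemma is_exp_subst:
  assumes "weight_raising \<rho>" "is_exp a e"
  shows "is_exp (\<lambda>k. subst \<rho> (a k)) (map_fps (subst \<rho>) e)"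
proof -
  have "map_fps (subst \<rho>) (Abs_fps (\<lambda>k. of_nat (Suc k) * a k)) = Abs_fps (\<lambda>k. of_nat (Suc k) * subst \<rho> (a k))"
    by (rule fps_ext) (simp add: subst_mult[OF assms(1)] del: of_nat_Suc)
  then show ?thesis
    using assms by (simp add: is_exp_def flip: map_fps_subst_deriv) (simp add: map_fps_subst_mult)
qed

section \<open>Residues\<close>

text \<open>\<open>R\<close> is the coefficient of \<open>z\<^sup>-\<^sup>k\<close> in \<open>e(z) G(z\<^sup>-\<^sup>1)\<close>; the series \<open>G\<close> enters
  through its evaluations at all \<open>u\<close> without constant term.\<close>
definition pairing :: "int \<Rightarrow> 'v::weighted ps fps \<Rightarrow> ('v ps \<Rightarrow> 'v ps) \<Rightarrow> 'v ps \<Rightarrow> bool" where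
  "pairing k e G R \<longleftrightarrow> (\<exists>c. (\<forall>u\<in>ord_ge 1. hsum (\<lambda>n. u ^ n * c n) (G u)) \<and>
     (\<forall>n. e $ n \<in> ord_ge n) \<and>
     hsum (\<lambda>n. e $ n * (if int n + k < 0 then 0 else c (nat (int n + k)))) R)"

lemma hsum_cong: "hsum X s \<Longrightarrow> (\<And>n. X n = Y n) \<Longrightarrow> hsum Y s"
  by (simp add: hsum_def)

lemma hsum_eval_zero:
  assumes "hsum (\<lambda>n. 0 ^ n * c n) s"
  shows "s = c 0"
proof (rule hsum_unique[OF assms])
  have "hsum (\<lambda>n. 0 ^ n * c n) (\<Sum>n<1. 0 ^ n * c n)"
    by (rule hsum_finite) (auto simp: power_0_left)
  then show "hsum (\<lambda>n. 0 ^ n * c n) (c 0)"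
    by simp
qed

text \<open>For n < d the index n + k is negative and for n > d the coefficient of \<open>e\<close>
  vanishes. Only n = d remains, where the index is 0 or negative.\<close>

lemma pairing_polynomial:
  assumes "pairing k e G R" "\<And>n. n > d \<Longrightarrow> e $ n = 0" "k \<le> - int d"
  shows "R = (if k = - int d then e $ d * G 0 else 0)"
proof -
  let ?cs = "\<lambda>c n. if int n + k < 0 then 0 else c (nat (int n + k))"
  obtain c where c: "\<And>u. u \<in> ord_ge 1 \<Longrightarrow> hsum (\<lambda>n. u ^ n * c n) (G u)"
    and e: "\<And>n. e $ n \<in> ord_ge n" and R: "hsum (\<lambda>n. e $ n * ?cs c n) R"
    using assms(1) by (auto simp: pairing_def)
  have G0: "G 0 = c 0"
    by (rule hsum_eval_zero) (use c[of 0] in simp)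
  have "hsum (\<lambda>n. e $ n * ?cs c n) (\<Sum>n<Suc d. e $ n * ?cs c n)"
    by (rule hsum_finite) (auto intro: ord_ge_mult_right e simp: assms(2))
  then have "R = (\<Sum>n<Suc d. e $ n * ?cs c n)"
    by (rule hsum_unique[OF R])
  also have "\<dots> = (\<Sum>n\<in>{d}. e $ n * ?cs c n)"
    by (rule sum.mono_neutral_right) (use assms(3) in auto)
  also have "\<dots> = (if k = - int d then e $ d * G 0 else 0)"
    using assms(3) by (auto simp: G0)
  finally show ?thesis .
qed

text \<open>The residue is the sum of u^n c_(n-1) over positive n, that is, \<open>u\<close> times
  the expansion of \<open>G u\<close>.\<close>

lemma pairing_geom_m1:
  assumes "pairing (- 1) (geom u) G R" "u \<in> ord_ge 1"
  shows "R = u * G u"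
proof -
  obtain c where c: "hsum (\<lambda>n. u ^ n * c n) (G u)"
    and R: "hsum (\<lambda>n. geom u $ n * (if int n + - 1 < 0 then 0 else c (nat (int n + - 1)))) R"
    using assms by (auto simp: pairing_def)
  show ?thesis
  proof (rule hsum_unique[OF R])
    show "hsum (\<lambda>n. geom u $ n * (if int n + - 1 < 0 then 0 else c (nat (int n + - 1)))) (u * G u)"
      by (rule hsum_cong[OF hsum_unshift[OF c assms(2)]]) (auto split: nat.split simp: mult.assoc)
  qed
qed

text \<open>The sum of u^n c_(n+1), once multiplied by \<open>u\<close>, misses only the term c_0 of
  the expansion of \<open>G u\<close>.\<close>

lemma pairing_geom_1:
  assumes "pairing 1 (geom u) G R" "u \<in> ord_ge 1"
  shows "u * R = G u - G 0"
proof -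
  obtain c where c: "\<And>u. u \<in> ord_ge 1 \<Longrightarrow> hsum (\<lambda>n. u ^ n * c n) (G u)"
    and R: "hsum (\<lambda>n. geom u $ n * (if int n + 1 < 0 then 0 else c (nat (int n + 1)))) R"
    using assms by (auto simp: pairing_def)
  have G0: "G 0 = c 0"
    by (rule hsum_eval_zero) (use c[of 0] in simp)
  have "u ^ n * c n \<in> ord_ge n" for n
    using ord_ge_power[OF assms(2), of n] by (simp add: ord_ge_mult_right)
  from hsum_shift[OF c[OF assms(2)] this]
  have 1: "hsum (\<lambda>n. u ^ Suc n * c (Suc n)) (G u - G 0)"
    by (simp add: G0)
  have 2: "hsum (\<lambda>n. u ^ Suc n * c (Suc n)) (u * R)"
    by (rule hsum_cong[OF hsum_mult_left[OF R, of u]]) (simp add: mult.assoc nat_add_distrib)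
  show ?thesis
    by (rule hsum_unique[OF 2 1])
qed

text \<open>Partial fractions without division: coefficient \<open>n\<close> of the product, times
  \<open>u - w\<close>, is u^(n+1) - w^(n+1).\<close>

lemma pairing_geom_geom:
  assumes "pairing 0 (geom u * geom w) G R" "u \<in> ord_ge 1" "w \<in> ord_ge 1"
  shows "(u - w) * R = u * G u - w * G w"
proof -
  obtain c where c: "\<And>u. u \<in> ord_ge 1 \<Longrightarrow> hsum (\<lambda>n. u ^ n * c n) (G u)"
    and R: "hsum (\<lambda>n. (geom u * geom w) $ n * (if int n + 0 < 0 then 0 else c (nat (int n + 0)))) R"
    using assms by (auto simp: pairing_def)
  have *: "(u - w) * (geom u * geom w) $ n = u ^ Suc n - w ^ Suc n" for n
  proof -
    have "(geom u * geom w) $ n = (\<Sum>i<Suc n. u ^ i * w ^ (n - i))"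
      by (simp add: fps_mult_nth atLeast0AtMost lessThan_Suc_atMost)
    moreover have "u ^ Suc n - w ^ Suc n = (u - w) * (\<Sum>i<Suc n. u ^ i * w ^ (n - i))"
      by (subst power_diff_sumr2) (auto intro!: sum.cong simp: mult.commute)
    ultimately show ?thesis by simp
  qed
  have 1: "hsum (\<lambda>n. u * (u ^ n * c n) - w * (w ^ n * c n)) (u * G u - w * G w)"
    by (intro hsum_diff hsum_mult_left c assms)
  have 2: "hsum (\<lambda>n. u * (u ^ n * c n) - w * (w ^ n * c n)) ((u - w) * R)"
  proof (rule hsum_cong[OF hsum_mult_left[OF R, of "u - w"]])
    fix n
    have "(u - w) * ((geom u * geom w) $ n * c n) = (u ^ Suc n - w ^ Suc n) * c n"
      by (simp only: mult.assoc[symmetric] *)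
    then show "(u - w) * ((geom u * geom w) $ n * (if int n + 0 < 0 then 0 else c (nat (int n + 0))))
       = u * (u ^ n * c n) - w * (w ^ n * c n)"
      by (simp add: algebra_simps)
  qed
  show ?thesis
    by (rule hsum_unique[OF 2 1])
qed

text \<open>Specialisation to \<open>t' = t + a\<close>, \<open>tbar' = tbar + b\<close>, \<open>z\<^sup>\<plusminus>\<^sup>1 = u\<close>.\<close>
fun specialize :: "(nat \<Rightarrow> var ps) \<Rightarrow> (nat \<Rightarrow> var ps) \<Rightarrow> var ps \<Rightarrow> var \<Rightarrow> var ps" where
  "specialize a b u (P v) = pvar (P v)"
| "specialize a b u (Q v) = shift_vars P a b v"
| "specialize a b u Z = u"
| "specialize a b u L = pvar L"
| "specialize a b u M = pvar M"

lemma weight_raising_specialize: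
  assumes "graded a" "graded b" "u \<in> ord_ge 1"
  shows "weight_raising (specialize a b u)"
  unfolding weight_raising_def
proof
  fix v
  show "specialize a b u v \<in> ord_ge (wt v)"
    using weight_raising_shift_vars[of P a b] pvar_ord_ge[of v] assms
    by (cases v) (simp_all add: weight_raising_def)
qed

lemma subst_shifted:
  assumes "weight_raising \<rho>" "\<And>v. wt (base v) = wt v" "graded a" "graded b"
    and "\<And>v. \<rho> (base v) = shift_vars P a' b' v"
  shows "subst \<rho> (shifted f base a b)
    = shifted f P (\<lambda>k. a' k + subst \<rho> (a k)) (\<lambda>k. b' k + subst \<rho> (b k))"
proof -
  have "(\<lambda>v. subst \<rho> (shift_vars base a b v))
    = shift_vars P (\<lambda>k. a' k + subst \<rho> (a k)) (\<lambda>k. b' k + subst \<rho> (b k))"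
    using assms(1,5)
    by (auto simp: fun_eq_iff shift_vars_def subst_add subst_pvar ac_simps split: tv.split)
  then show ?thesis
    unfolding shifted_def by (simp add: subst_subst assms weight_raising_shift_vars)
qed

lemma Ps_res_inf:
  assumes "is_exp d (vfps Z (Ps E))" "graded d"
  shows "hsum (\<lambda>n. cvar Z n (Ps E) * (if int n + (N + 1) < 0 then 0 else cvar Z (nat (int n + (N + 1))) (Ps F)))
     (Ps (res_inf N E F))"
proof -
  have "cvar Z n (Ps E) \<in> ord_ge n" for n
    using is_exp_ord_ge[OF assms, of n] by (simp add: vfps_def)
  moreover have eq: "Ps (ps_mult (ps_coeff_var Z n E) (ps_coeff_var_int Z (int n + N + 1) F))
     = cvar Z n (Ps E) * (if int n + (N + 1) < 0 then 0 else cvar Z (nat (int n + (N + 1))) (Ps F))" for n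
    by (simp add: Ps_mult cvar_def ps_coeff_var_int_def zero_ps_def add.assoc)
  ultimately show ?thesis
    unfolding res_inf_def eq[symmetric]
    by (intro hsum_infsum) (simp add: eq ord_ge_mult_right del: Ps_inject')
qed

text \<open>Replacing z by 1/z turns z^N dz into - z^(-N-2) dz and the expansion at 0 into one at
  infinity; the sign goes into the orientation.\<close>

lemma res_zero_eq_res_inf: "res_zero N E G = res_inf (- N - 2) E G"
  by (simp add: res_zero_def res_inf_def algebra_simps)

text \<open>A residue of the definitions becomes a \<open>pairing\<close> with a closed form
  \<open>e\<close> of the specialised exponential. The coefficients of \<open>F\<close> in
  \<open>Z\<close> stay unknown; only the values of \<open>F\<close> at \<open>u\<close> enter later
  computations.\<close>

lemma pairing_res_inf:
  assumes "graded a" "graded b"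
    and d: "graded (\<lambda>k. of_mpoly (d k))" "\<And>k. free_of Z (of_mpoly (d k))"
    and e: "is_exp (\<lambda>k. subst (specialize a b 0) (of_mpoly (d k))) e"
  shows "pairing (N + 1) e (\<lambda>u. subst (specialize a b u) (Ps F))
    (subst (specialize a b 0) (Ps (res_inf N (exp_xi d Z) F)))"
proof -
  let ?\<rho> = "specialize a b 0"
  let ?E = "Ps (exp_xi d Z)"
  define c where "c n = subst ?\<rho> (cvar Z n (Ps F))" for n
  have wr: "weight_raising (specialize a b u)" if "u \<in> ord_ge 1" for u
    using assms(1,2) that by (rule weight_raising_specialize)
  have ex: "is_exp (\<lambda>k. of_mpoly (d k)) (vfps Z ?E)"
    by (rule is_exp_exp_xi[OF d])
  \<comment> \<open>Both series solve the same differential equation with initial value 1.\<close>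
  have "map_fps (subst ?\<rho>) (vfps Z ?E) = e"
    by (rule is_exp_unique[OF is_exp_subst[OF wr ex] e]) simp
  then have e_nth: "e $ n = subst ?\<rho> (cvar Z n ?E)" for n
    by (auto simp: vfps_def)
  have "hsum (\<lambda>n. u ^ n * c n) (subst (specialize a b u) (Ps F))" if "u \<in> ord_ge 1" for u
  proof -
    \<comment> \<open>Coefficients in \<open>Z\<close> are free of \<open>Z\<close>, so one sequence
      \<open>c\<close> serves for all values \<open>u\<close>.\<close>
    have "subst (specialize a b u) (cvar Z n (Ps F)) = c n" for n
      unfolding c_def
    proof (rule subst_cong_free[of Z])
      fix v assume "v \<noteq> Z"
      then show "specialize a b u v = ?\<rho> v" by (cases v) auto
    qed simp
    then show ?thesis
      using hsum_subst_cvar[OF wr[OF that], of Z "Ps F"] by simp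
  qed
  moreover have "e $ n \<in> ord_ge n" for n
    unfolding e_nth using is_exp_ord_ge[OF ex d(1), of n]
    by (intro subst_ord_ge wr) (auto simp: vfps_def)
  moreover have "hsum (\<lambda>n. e $ n * (if int n + (N + 1) < 0 then 0 else c (nat (int n + (N + 1)))))
      (subst ?\<rho> (Ps (res_inf N (exp_xi d Z) F)))"
    by (rule hsum_cong[OF subst_hsum[OF wr Ps_res_inf[OF ex d(1)]]])
      (auto simp: subst_mult[OF wr] e_nth c_def)
  ultimately show ?thesis
    unfolding pairing_def by blast
qed

lemma subst_tau_product:
  assumes "graded a" "graded b" "u \<in> ord_ge 1"
    and "graded (\<lambda>k. of_mpoly (x k))" "graded (\<lambda>k. of_mpoly (y k))"
    and "graded (\<lambda>k. of_mpoly (x' k))" "graded (\<lambda>k. of_mpoly (y' k))"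
  shows "subst (specialize a b u) (Ps (ps_mult (tau_at f Q x y) (tau_at g P x' y')))
    = shifted f P (\<lambda>k. a k + subst (specialize a b u) (of_mpoly (x k)))
        (\<lambda>k. b k + subst (specialize a b u) (of_mpoly (y k)))
    * shifted g P (\<lambda>k. subst (specialize a b u) (of_mpoly (x' k)))
        (\<lambda>k. subst (specialize a b u) (of_mpoly (y' k)))"
proof -
  have wr: "weight_raising (specialize a b u)"
    using assms(1-3) by (rule weight_raising_specialize)
  have "subst (specialize a b u) (shifted g P (\<lambda>k. of_mpoly (x' k)) (\<lambda>k. of_mpoly (y' k)))
    = shifted g P (\<lambda>k. 0 + subst (specialize a b u) (of_mpoly (x' k)))
        (\<lambda>k. 0 + subst (specialize a b u) (of_mpoly (y' k)))"
    by (rule subst_shifted) (auto simp: wr assms shift_vars_def split: tv.split)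
  moreover have "subst (specialize a b u) (shifted f Q (\<lambda>k. of_mpoly (x k)) (\<lambda>k. of_mpoly (y k)))
    = shifted f P (\<lambda>k. a k + subst (specialize a b u) (of_mpoly (x k)))
        (\<lambda>k. b k + subst (specialize a b u) (of_mpoly (y k)))"
    by (rule subst_shifted) (auto simp: wr assms)
  ultimately show ?thesis
    by (simp add: Ps_mult Ps_tau_at subst_mult wr assms)
qed

section \<open>The bilinear equation at shifted arguments\<close>

lemma pairing_cong:
  "pairing k e G R \<Longrightarrow> k = k' \<Longrightarrow> (\<And>u. u \<in> ord_ge 1 \<Longrightarrow> G u = H u) \<Longrightarrow> pairing k' e H R"
  by (simp add: pairing_def)

lemma free_of_pvar_diff: "v \<noteq> z \<Longrightarrow> w \<noteq> z \<Longrightarrow> free_of z (pvar v - pvar w)"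
  by (auto simp: free_of_def pvar_def coeff_monom lookup_single)

lemma graded_pvar_diff:
  "(\<And>k. wt (v k) = Suc k) \<Longrightarrow> (\<And>k. wt (w k) = Suc k) \<Longrightarrow> graded (\<lambda>k. pvar (v k) - pvar (w k))"
  unfolding graded_def by (metis ord_ge_diff pvar_ord_ge)

text \<open>The unprimed variables stay put and the primed ones become \<open>a\<close>,
  \<open>b\<close> shifts of them, so the exponents specialise to \<open>a\<close>,
  \<open>- a\<close>, \<open>b\<close>, \<open>- b\<close>. Each offset is the power of z in the
  residue plus 1, after inversion of z for \<open>R3\<close> and \<open>R4\<close>.\<close>

lemma bilinear_specialized:
  fixes \<tau> :: tau and s r s' r' :: int
  assumes "pfaff_toda_tau \<tau>" and a: "graded a" and b: "graded b"
    and e: "is_exp a e" "is_exp (\<lambda>k. - a k) e'"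
    and f: "is_exp b f" "is_exp (\<lambda>k. - b k) f'"
  obtains R1 R2 R3 R4 where "R1 + R2 = R3 + R4"
    "pairing (s' + r' - s - r + 1) e (\<lambda>u. shifted (\<tau> s' r') P (\<lambda>k. a k - mw u k) b
        * shifted (\<tau> s r) P (mw u) (\<lambda>k. 0)) R1"
    "pairing (s + r - s' - r' - 3) e' (\<lambda>u. shifted (\<tau> (s' + 1) (r' + 1)) P (\<lambda>k. a k + mw u k) b
        * shifted (\<tau> (s - 1) (r - 1)) P (\<lambda>k. - mw u k) (\<lambda>k. 0)) R2"
    "pairing (s - r - s' + r' - 1) f (\<lambda>u. shifted (\<tau> (s' + 1) r') P a (\<lambda>k. b k - mw u k)
        * shifted (\<tau> (s - 1) r) P (\<lambda>k. 0) (mw u)) R3"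
    "pairing (s' - r' - s + r - 1) f' (\<lambda>u. shifted (\<tau> s' (r' + 1)) P a (\<lambda>k. b k + mw u k)
        * shifted (\<tau> s (r - 1)) P (\<lambda>k. 0) (\<lambda>k. - mw u k)) R4"
proof -
  define F1 where "F1 = ps_mult (tau_at (\<tau> s' r') Q (\<lambda>k. - miwa Z k) noshift)
                      (tau_at (\<tau> s r) P (\<lambda>k. miwa Z k) noshift)"
  define F2 where "F2 = ps_mult (tau_at (\<tau> (s' + 1) (r' + 1)) Q (\<lambda>k. miwa Z k) noshift)
                      (tau_at (\<tau> (s - 1) (r - 1)) P (\<lambda>k. - miwa Z k) noshift)"
  define F3 where "F3 = ps_mult (tau_at (\<tau> (s' + 1) r') Q noshift (\<lambda>k. - miwa Z k))
                      (tau_at (\<tau> (s - 1) r) P noshift (\<lambda>k. miwa Z k))"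
  define F4 where "F4 = ps_mult (tau_at (\<tau> s' (r' + 1)) Q noshift (\<lambda>k. miwa Z k))
                      (tau_at (\<tau> s (r - 1)) P noshift (\<lambda>k. - miwa Z k))"
  define S where "S f = subst (specialize a b 0) (Ps f)" for f
  note wr = weight_raising_specialize[OF a b]
  have gZ: "graded (mw (pvar Z))" "graded (\<lambda>k. - mw (pvar Z) k)"
    using pvar_ord_ge_1 by blast+
  have G: "graded (\<lambda>k. of_mpoly (tQ k - tP k))" "graded (\<lambda>k. of_mpoly (tP k - tQ k))"
      "graded (\<lambda>k. of_mpoly (tbQ k - tbP k))" "graded (\<lambda>k. of_mpoly (tbP k - tbQ k))"
    by (simp_all add: graded_pvar_diff)
  have fr: "free_of Z (of_mpoly (tQ k - tP k))" "free_of Z (of_mpoly (tP k - tQ k))"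
      "free_of Z (of_mpoly (tbQ k - tbP k))" "free_of Z (of_mpoly (tbP k - tbQ k))" for k
    by (simp_all add: free_of_pvar_diff)
  have sub: "subst (specialize a b 0) (of_mpoly (tQ k - tP k)) = a k"
      "subst (specialize a b 0) (of_mpoly (tP k - tQ k)) = - a k"
      "subst (specialize a b 0) (of_mpoly (tbQ k - tbP k)) = b k"
      "subst (specialize a b 0) (of_mpoly (tbP k - tbQ k)) = - b k" for k
    by (simp_all add: subst_diff subst_pvar wr shift_vars_def)
  have "ps_add (res_inf (s' + r' - s - r) (exp_xi (\<lambda>k. tQ k - tP k) Z) F1)
          (res_inf (s + r - s' - r' - 4) (exp_xi (\<lambda>k. tP k - tQ k) Z) F2)
      = ps_add (res_zero (s' - r' - s + r) (exp_xi (\<lambda>k. tbQ k - tbP k) Z) F3)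
          (res_zero (s - r - s' + r') (exp_xi (\<lambda>k. tbP k - tbQ k) Z) F4)"
    using assms(1) unfolding pfaff_toda_tau_def F1_def F2_def F3_def F4_def by blast
  from arg_cong[OF this, of S]
  have sum: "S (res_inf (s' + r' - s - r) (exp_xi (\<lambda>k. tQ k - tP k) Z) F1)
        + S (res_inf (s + r - s' - r' - 4) (exp_xi (\<lambda>k. tP k - tQ k) Z) F2)
      = S (res_inf (- (s' - r' - s + r) - 2) (exp_xi (\<lambda>k. tbQ k - tbP k) Z) F3)
        + S (res_inf (- (s - r - s' + r') - 2) (exp_xi (\<lambda>k. tbP k - tbQ k) Z) F4)"
    by (simp only: S_def Ps_add subst_add res_zero_eq_res_inf)
  have u: "subst (specialize a b u) (mw (pvar Z) k) = mw u k" if "u \<in> ord_ge 1" for u k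
    using wr[OF that] by (simp add: subst_mw subst_pvar)
  note simps = subst_tau_product[OF a b] noshift_def gZ graded_zero u subst_minus
  show ?thesis
  proof (rule that[OF sum])
    show "pairing (s' + r' - s - r + 1) e (\<lambda>u. shifted (\<tau> s' r') P (\<lambda>k. a k - mw u k) b
        * shifted (\<tau> s r) P (mw u) (\<lambda>k. 0))
        (S (res_inf (s' + r' - s - r) (exp_xi (\<lambda>k. tQ k - tP k) Z) F1))"
      unfolding S_def
      by (rule pairing_cong[OF pairing_res_inf[OF a b G(1) fr(1)]]) (simp_all add: sub[simplified] e F1_def simps)
    show "pairing (s + r - s' - r' - 3) e' (\<lambda>u. shifted (\<tau> (s' + 1) (r' + 1)) P (\<lambda>k. a k + mw u k) b
        * shifted (\<tau> (s - 1) (r - 1)) P (\<lambda>k. - mw u k) (\<lambda>k. 0))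
        (S (res_inf (s + r - s' - r' - 4) (exp_xi (\<lambda>k. tP k - tQ k) Z) F2))"
      unfolding S_def
      by (rule pairing_cong[OF pairing_res_inf[OF a b G(2) fr(2)]]) (simp_all add: sub[simplified] e F2_def simps)
    show "pairing (s - r - s' + r' - 1) f (\<lambda>u. shifted (\<tau> (s' + 1) r') P a (\<lambda>k. b k - mw u k)
        * shifted (\<tau> (s - 1) r) P (\<lambda>k. 0) (mw u))
        (S (res_inf (- (s' - r' - s + r) - 2) (exp_xi (\<lambda>k. tbQ k - tbP k) Z) F3))"
      unfolding S_def
      by (rule pairing_cong[OF pairing_res_inf[OF a b G(3) fr(3)]]) (simp_all add: sub[simplified] f F3_def simps)
    show "pairing (s' - r' - s + r - 1) f' (\<lambda>u. shifted (\<tau> s' (r' + 1)) P a (\<lambda>k. b k + mw u k)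
        * shifted (\<tau> s (r - 1)) P (\<lambda>k. 0) (\<lambda>k. - mw u k))
        (S (res_inf (- (s - r - s' + r') - 2) (exp_xi (\<lambda>k. tbP k - tbQ k) Z) F4))"
      unfolding S_def
      by (rule pairing_cong[OF pairing_res_inf[OF a b G(4) fr(4)]]) (simp_all add: sub[simplified] f F4_def simps)
  qed
qed

section \<open>Closed forms of the exponential factors and the residues against polynomials\<close>

lemma is_exp_mw2: "is_exp (\<lambda>k. mw u k + mw w k) (geom u * geom w)"
  by (rule is_exp_add[OF is_exp_mw is_exp_mw])

lemma is_exp_minus_mw2:
  "is_exp (\<lambda>k. - mw u k - mw w k) ((1 - fps_const u * fps_X) * (1 - fps_const w * fps_X))"
  using is_exp_add[OF is_exp_minus_mw[of u] is_exp_minus_mw[of w]] by simp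

lemmas exp_simps = is_exp_mw is_exp_minus_mw is_exp_mw2 is_exp_minus_mw2 is_exp_zero graded_zero

lemma one_minus_X_nth:
  "(1 - fps_const u * fps_X) $ n = (if n = 0 then 1 else if n = 1 then - u else (0 :: 'a::comm_ring_1))"
  by (auto simp: fps_X_def)

lemma one_minus_X_mult_nth:
  "((1 - fps_const u * fps_X) * f) $ Suc n = f $ Suc n - u * (f $ n :: 'a::comm_ring_1)"
  by (simp add: left_diff_distrib mult.assoc)

lemma pairing_one:
  "pairing k 1 G R \<Longrightarrow> k \<le> 0 \<Longrightarrow> R = (if k = 0 then G 0 else 0)"
  using pairing_polynomial[of k 1 G R 0] by simp

lemma pairing_poly1:
  "pairing k (1 - fps_const u * fps_X) G R \<Longrightarrow> k \<le> - 1 \<Longrightarrow> R = (if k = - 1 then - u * G 0 else 0)"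
  using pairing_polynomial[of k "1 - fps_const u * fps_X" G R 1] by (simp add: one_minus_X_nth)

lemma pairing_poly2:
  assumes "pairing k ((1 - fps_const u * fps_X) * (1 - fps_const w * fps_X)) G R" "k \<le> - 2"
  shows "R = (if k = - 2 then u * w * G 0 else 0)"
proof -
  let ?e = "(1 - fps_const u * fps_X) * (1 - fps_const w * fps_X)"
  have "?e $ n = 0" if "n > 2" for n
    using that by (cases n) (auto simp: one_minus_X_mult_nth one_minus_X_nth)
  moreover have "?e $ 2 = u * w"
    by (simp only: numeral_2_eq_2 one_minus_X_mult_nth one_minus_X_nth) simp
  ultimately show ?thesis
    using pairing_polynomial[OF assms(1), of 2] assms(2) by simp
qed

lemma Ps_tauS:
  assumes "graded (\<lambda>k. of_mpoly (a k))" "graded (\<lambda>k. of_mpoly (b k))"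
  shows "Ps (tauS \<tau> s r a b) = shifted (\<tau> s r) P (\<lambda>k. of_mpoly (a k)) (\<lambda>k. of_mpoly (b k))"
  unfolding tauS_def by (rule Ps_tau_at) (simp_all add: assms)

abbreviation "zr \<equiv> (\<lambda>k :: nat. 0 :: var ps)"
abbreviation "mw2 u w \<equiv> (\<lambda>k. mw u k + mw w k)"

section \<open>The six identities for arbitrary parameters of positive order\<close>

context
  fixes \<tau> :: tau and s r :: int and l m :: "var ps"
  assumes tau: "pfaff_toda_tau \<tau>" and l: "l \<in> ord_ge 1" and m: "m \<in> ord_ge 1"
begin

lemma graded_lm: "graded (mw l)" "graded (mw m)" "graded (mw2 l m)"
  using l m by blast+

abbreviation "T i j a b \<equiv> shifted (\<tau> i j) P a b"
abbreviation "X1 u \<equiv> 1 - fps_const u * (fps_X :: var ps fps)"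

text \<open>Here A = -1 and B = 1: \<open>R1\<close> is the divided difference of evaluations at
  \<open>l\<close> and \<open>m\<close>, \<open>R2\<close> is \<open>l * m\<close> times a value at
  0, \<open>R3\<close> vanishes and \<open>R4\<close> is a value at 0. With \<open>l\<close>,
  \<open>m\<close> in the role of the inverse parameters, -mu/(lambda - mu) becomes -l/(m - l),
  whence the factor \<open>m - l\<close>.\<close>

lemma identity_1a:
  "- l * (T (s + 1) r (mw m) zr * T (s + 1) (r + 1) (mw l) zr)
   + m * (T (s + 1) r (mw l) zr * T (s + 1) (r + 1) (mw m) zr)
   + (m - l) * l * m * (T (s + 2) (r + 1) (mw2 l m) zr * T s r zr zr)
   = (m - l) * (T (s + 1) (r + 1) (mw2 l m) zr * T (s + 1) r zr zr)"
proof -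
  obtain R1 R2 R3 R4 where R: "R1 + R2 = R3 + R4"
    "pairing 0 (geom l * geom m) (\<lambda>u. T (s + 1) r (\<lambda>k. mw2 l m k - mw u k) zr * T (s + 1) (r + 1) (mw u) zr) R1"
    "pairing (- 2) (X1 l * X1 m) (\<lambda>u. T (s + 2) (r + 1) (\<lambda>k. mw2 l m k + mw u k) zr * T s r (\<lambda>k. - mw u k) zr) R2"
    "pairing (- 2) (1) (\<lambda>u. T (s + 2) r (mw2 l m) (\<lambda>k. - mw u k) * T s (r + 1) zr (mw u)) R3"
    "pairing 0 (1) (\<lambda>u. T (s + 1) (r + 1) (mw2 l m) (mw u) * T (s + 1) r zr (\<lambda>k. - mw u k)) R4"
    by (rule bilinear_specialized[OF tau, where s' = "s + 1" and r' = "r" and s = "s + 1" and r = "r + 1"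
        and a = "mw2 l m" and b = "zr" and e = "geom l * geom m" and e' = "X1 l * X1 m" and f = "1" and f' = "1"])
      (simp_all add: graded_lm exp_simps add.commute[of 2 s] add.commute[of 2 r])
  note E = pairing_poly2[OF R(3), simplified] pairing_one[OF R(4), simplified] pairing_one[OF R(5), simplified]
  have "(l - m) * R1 + (l - m) * R2 = (l - m) * R3 + (l - m) * R4"
    using R(1) by (simp add: distrib_left[symmetric])
  then show ?thesis
    unfolding pairing_geom_geom[OF R(2) l m, simplified] E by (simp add: algebra_simps)
qed

text \<open>Now A = B = -1, which exchanges the roles of \<open>R3\<close> and
  \<open>R4\<close>.\<close>

lemma identity_1b:
  "- l * (T s (r + 1) (mw m) zr * T (s + 1) (r + 1) (mw l) zr)
   + m * (T s (r + 1) (mw l) zr * T (s + 1) (r + 1) (mw m) zr)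
   + (m - l) * l * m * (T (s + 1) (r + 2) (mw2 l m) zr * T s r zr zr)
   = (m - l) * (T (s + 1) (r + 1) (mw2 l m) zr * T s (r + 1) zr zr)"
proof -
  obtain R1 R2 R3 R4 where R: "R1 + R2 = R3 + R4"
    "pairing 0 (geom l * geom m) (\<lambda>u. T s (r + 1) (\<lambda>k. mw2 l m k - mw u k) zr * T (s + 1) (r + 1) (mw u) zr) R1"
    "pairing (- 2) (X1 l * X1 m) (\<lambda>u. T (s + 1) (r + 2) (\<lambda>k. mw2 l m k + mw u k) zr * T s r (\<lambda>k. - mw u k) zr) R2"
    "pairing 0 (1) (\<lambda>u. T (s + 1) (r + 1) (mw2 l m) (\<lambda>k. - mw u k) * T s (r + 1) zr (mw u)) R3"
    "pairing (- 2) (1) (\<lambda>u. T s (r + 2) (mw2 l m) (mw u) * T (s + 1) r zr (\<lambda>k. - mw u k)) R4"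
    by (rule bilinear_specialized[OF tau, where s' = "s" and r' = "r + 1" and s = "s + 1" and r = "r + 1"
        and a = "mw2 l m" and b = "zr" and e = "geom l * geom m" and e' = "X1 l * X1 m" and f = "1" and f' = "1"])
      (simp_all add: graded_lm exp_simps add.commute[of 2 s] add.commute[of 2 r])
  note E = pairing_poly2[OF R(3), simplified] pairing_one[OF R(4), simplified] pairing_one[OF R(5), simplified]
  have "(l - m) * R1 + (l - m) * R2 = (l - m) * R3 + (l - m) * R4"
    using R(1) by (simp add: distrib_left[symmetric])
  then show ?thesis
    unfolding pairing_geom_geom[OF R(2) l m, simplified] E by (simp add: algebra_simps)
qed

text \<open>With A = -3 and B = -1 the divided difference is \<open>R3\<close>, while on the left
  \<open>R1\<close> vanishes and \<open>R2\<close> is a value at 0.\<close>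

lemma identity_2a:
  "(l - m) * (T s (r + 1) zr (mw2 l m) * T s r zr zr)
   = l * (T s r zr (mw m) * T s (r + 1) zr (mw l)) - m * (T s r zr (mw l) * T s (r + 1) zr (mw m))
   + (l - m) * l * m * (T (s - 1) (r + 1) zr (mw2 l m) * T (s + 1) r zr zr)"
proof -
  obtain R1 R2 R3 R4 where R: "R1 + R2 = R3 + R4"
    "pairing (- 2) (1) (\<lambda>u. T (s - 1) r (\<lambda>k. - mw u k) (mw2 l m) * T (s + 1) (r + 1) (mw u) zr) R1"
    "pairing 0 (1) (\<lambda>u. T s (r + 1) (mw u) (mw2 l m) * T s r (\<lambda>k. - mw u k) zr) R2"
    "pairing 0 (geom l * geom m) (\<lambda>u. T s r zr (\<lambda>k. mw2 l m k - mw u k) * T s (r + 1) zr (mw u)) R3"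
    "pairing (- 2) (X1 l * X1 m) (\<lambda>u. T (s - 1) (r + 1) zr (\<lambda>k. mw2 l m k + mw u k) * T (s + 1) r zr (\<lambda>k. - mw u k)) R4"
    by (rule bilinear_specialized[OF tau, where s' = "s - 1" and r' = "r" and s = "s + 1" and r = "r + 1"
        and a = "zr" and b = "mw2 l m" and e = "1" and e' = "1" and f = "geom l * geom m" and f' = "X1 l * X1 m"])
      (simp_all add: graded_lm exp_simps add.commute[of 2 s] add.commute[of 2 r])
  note E = pairing_one[OF R(2), simplified] pairing_one[OF R(3), simplified] pairing_poly2[OF R(5), simplified]
  have "(l - m) * R1 + (l - m) * R2 = (l - m) * R3 + (l - m) * R4"
    using R(1) by (simp add: distrib_left[symmetric])
  then show ?thesis
    unfolding pairing_geom_geom[OF R(4) l m, simplified] E by (simp add: algebra_simps)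
qed

lemma identity_2b:
  "(l - m) * (T s (r + 1) zr (mw2 l m) * T (s + 1) (r + 1) zr zr)
   = l * (T (s + 1) (r + 1) zr (mw m) * T s (r + 1) zr (mw l)) - m * (T (s + 1) (r + 1) zr (mw l) * T s (r + 1) zr (mw m))
   + (l - m) * l * m * (T s (r + 2) zr (mw2 l m) * T (s + 1) r zr zr)"
proof -
  obtain R1 R2 R3 R4 where R: "R1 + R2 = R3 + R4"
    "pairing 0 (1) (\<lambda>u. T s (r + 1) (\<lambda>k. - mw u k) (mw2 l m) * T (s + 1) (r + 1) (mw u) zr) R1"
    "pairing (- 2) (1) (\<lambda>u. T (s + 1) (r + 2) (mw u) (mw2 l m) * T s r (\<lambda>k. - mw u k) zr) R2"
    "pairing 0 (geom l * geom m) (\<lambda>u. T (s + 1) (r + 1) zr (\<lambda>k. mw2 l m k - mw u k) * T s (r + 1) zr (mw u)) R3"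
    "pairing (- 2) (X1 l * X1 m) (\<lambda>u. T s (r + 2) zr (\<lambda>k. mw2 l m k + mw u k) * T (s + 1) r zr (\<lambda>k. - mw u k)) R4"
    by (rule bilinear_specialized[OF tau, where s' = "s" and r' = "r + 1" and s = "s + 1" and r = "r + 1"
        and a = "zr" and b = "mw2 l m" and e = "1" and e' = "1" and f = "geom l * geom m" and f' = "X1 l * X1 m"])
      (simp_all add: graded_lm exp_simps add.commute[of 2 s] add.commute[of 2 r])
  note E = pairing_one[OF R(2), simplified] pairing_one[OF R(3), simplified] pairing_poly2[OF R(5), simplified]
  have "(l - m) * R1 + (l - m) * R2 = (l - m) * R3 + (l - m) * R4"
    using R(1) by (simp add: distrib_left[symmetric])
  then show ?thesis
    unfolding pairing_geom_geom[OF R(4) l m, simplified] E by (simp add: algebra_simps)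
qed

text \<open>With A = -2 and B = 0 all four offsets are -1: each geometric factor gives an
  evaluation, and each linear factor gives minus its parameter times a value at 0.\<close>

lemma identity_3a:
  "l * (T s r zr (mw m) * T (s + 1) (r + 1) (mw l) zr) - l * (T (s + 1) (r + 1) (mw l) (mw m) * T s r zr zr)
   = m * (T (s + 1) r (mw l) zr * T s (r + 1) zr (mw m)) - m * (T s (r + 1) (mw l) (mw m) * T (s + 1) r zr zr)"
proof -
  obtain R1 R2 R3 R4 where R: "R1 + R2 = R3 + R4"
    "pairing (- 1) (geom l) (\<lambda>u. T s r (\<lambda>k. mw l k - mw u k) (mw m) * T (s + 1) (r + 1) (mw u) zr) R1"
    "pairing (- 1) (X1 l) (\<lambda>u. T (s + 1) (r + 1) (\<lambda>k. mw l k + mw u k) (mw m) * T s r (\<lambda>k. - mw u k) zr) R2"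
    "pairing (- 1) (geom m) (\<lambda>u. T (s + 1) r (mw l) (\<lambda>k. mw m k - mw u k) * T s (r + 1) zr (mw u)) R3"
    "pairing (- 1) (X1 m) (\<lambda>u. T s (r + 1) (mw l) (\<lambda>k. mw m k + mw u k) * T (s + 1) r zr (\<lambda>k. - mw u k)) R4"
    by (rule bilinear_specialized[OF tau, where s' = "s" and r' = "r" and s = "s + 1" and r = "r + 1"
        and a = "mw l" and b = "mw m" and e = "geom l" and e' = "X1 l" and f = "geom m" and f' = "X1 m"])
      (simp_all add: graded_lm exp_simps add.commute[of 2 s] add.commute[of 2 r])
  note E = pairing_geom_m1[OF R(2) l, simplified] pairing_poly1[OF R(3), simplified] pairing_poly1[OF R(5), simplified]
  from R(1) show ?thesis
    unfolding pairing_geom_m1[OF R(4) m, simplified] E by (simp add: algebra_simps)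
qed

text \<open>With A = B = -2 the offset -3 kills \<open>R4\<close>, and the offset 1 makes
  \<open>m * R3\<close> a difference of two values; hence the multiplication by
  \<open>m\<close>.\<close>

lemma identity_3b:
  "m * l * (T (s - 1) (r + 1) zr (mw m) * T (s + 1) (r + 1) (mw l) zr) - m * l * (T s (r + 2) (mw l) (mw m) * T s r zr zr)
   = T s (r + 1) (mw l) zr * T s (r + 1) zr (mw m) - T s (r + 1) (mw l) (mw m) * T s (r + 1) zr zr"
proof -
  obtain R1 R2 R3 R4 where R: "R1 + R2 = R3 + R4"
    "pairing (- 1) (geom l) (\<lambda>u. T (s - 1) (r + 1) (\<lambda>k. mw l k - mw u k) (mw m) * T (s + 1) (r + 1) (mw u) zr) R1"
    "pairing (- 1) (X1 l) (\<lambda>u. T s (r + 2) (\<lambda>k. mw l k + mw u k) (mw m) * T s r (\<lambda>k. - mw u k) zr) R2"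
    "pairing 1 (geom m) (\<lambda>u. T s (r + 1) (mw l) (\<lambda>k. mw m k - mw u k) * T s (r + 1) zr (mw u)) R3"
    "pairing (- 3) (X1 m) (\<lambda>u. T (s - 1) (r + 2) (mw l) (\<lambda>k. mw m k + mw u k) * T (s + 1) r zr (\<lambda>k. - mw u k)) R4"
    by (rule bilinear_specialized[OF tau, where s' = "s - 1" and r' = "r + 1" and s = "s + 1" and r = "r + 1"
        and a = "mw l" and b = "mw m" and e = "geom l" and e' = "X1 l" and f = "geom m" and f' = "X1 m"])
      (simp_all add: graded_lm exp_simps add.commute[of 2 s] add.commute[of 2 r])
  note E = pairing_geom_m1[OF R(2) l, simplified] pairing_poly1[OF R(3), simplified] pairing_poly1[OF R(5), simplified]
  have "m * R1 + m * R2 = m * R3 + m * R4"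
    using R(1) by (simp add: distrib_left[symmetric])
  then show ?thesis
    unfolding pairing_geom_1[OF R(4) m, simplified] E by (simp add: algebra_simps)
qed

end

theorem theorem4:
  fixes \<tau> :: tau and s r :: int
  assumes "pfaff_toda_tau \<tau>"
  shows "\<comment> \<open>(1a): L = lambda^(-1), M = mu^(-1); cleared of the denominator (lambda - mu)\<close>
     (ps_add
       (ps_add
         (ps_pmult (- pVar L) (ps_mult (tauS \<tau> (s + 1) r (miwa M) noshift) (tauS \<tau> (s + 1) (r + 1) (miwa L) noshift)))
         (ps_pmult (pVar M) (ps_mult (tauS \<tau> (s + 1) r (miwa L) noshift) (tauS \<tau> (s + 1) (r + 1) (miwa M) noshift))))
       (ps_pmult ((pVar M - pVar L) * pVar L * pVar M)
         (ps_mult (tauS \<tau> (s + 2) (r + 1) (miwa2 L M) noshift) (tauS \<tau> s r noshift noshift)))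
     = ps_pmult (pVar M - pVar L)
         (ps_mult (tauS \<tau> (s + 1) (r + 1) (miwa2 L M) noshift) (tauS \<tau> (s + 1) r noshift noshift))) \<and>
     \<comment> \<open>(1b): L = lambda^(-1), M = mu^(-1); cleared of the denominator (lambda - mu)\<close>
     (ps_add
       (ps_add
         (ps_pmult (- pVar L) (ps_mult (tauS \<tau> s (r + 1) (miwa M) noshift) (tauS \<tau> (s + 1) (r + 1) (miwa L) noshift)))
         (ps_pmult (pVar M) (ps_mult (tauS \<tau> s (r + 1) (miwa L) noshift) (tauS \<tau> (s + 1) (r + 1) (miwa M) noshift))))
       (ps_pmult ((pVar M - pVar L) * pVar L * pVar M)
         (ps_mult (tauS \<tau> (s + 1) (r + 2) (miwa2 L M) noshift) (tauS \<tau> s r noshift noshift)))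
     = ps_pmult (pVar M - pVar L)
         (ps_mult (tauS \<tau> (s + 1) (r + 1) (miwa2 L M) noshift) (tauS \<tau> s (r + 1) noshift noshift))) \<and>
     \<comment> \<open>(2a): L = lambda, M = mu; multiplied by (lambda - mu)\<close>
     (ps_pmult (pVar L - pVar M)
       (ps_mult (tauS \<tau> s (r + 1) noshift (miwa2 L M)) (tauS \<tau> s r noshift noshift))
     = ps_add
         (ps_diff
           (ps_pmult (pVar L) (ps_mult (tauS \<tau> s r noshift (miwa M)) (tauS \<tau> s (r + 1) noshift (miwa L))))
           (ps_pmult (pVar M) (ps_mult (tauS \<tau> s r noshift (miwa L)) (tauS \<tau> s (r + 1) noshift (miwa M)))))
         (ps_pmult ((pVar L - pVar M) * pVar L * pVar M)
           (ps_mult (tauS \<tau> (s - 1) (r + 1) noshift (miwa2 L M)) (tauS \<tau> (s + 1) r noshift noshift)))) \<and>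
     \<comment> \<open>(2b): L = lambda, M = mu; multiplied by (lambda - mu)\<close>
     (ps_pmult (pVar L - pVar M)
       (ps_mult (tauS \<tau> s (r + 1) noshift (miwa2 L M)) (tauS \<tau> (s + 1) (r + 1) noshift noshift))
     = ps_add
         (ps_diff
           (ps_pmult (pVar L) (ps_mult (tauS \<tau> (s + 1) (r + 1) noshift (miwa M)) (tauS \<tau> s (r + 1) noshift (miwa L))))
           (ps_pmult (pVar M) (ps_mult (tauS \<tau> (s + 1) (r + 1) noshift (miwa L)) (tauS \<tau> s (r + 1) noshift (miwa M)))))
         (ps_pmult ((pVar L - pVar M) * pVar L * pVar M)
           (ps_mult (tauS \<tau> s (r + 2) noshift (miwa2 L M)) (tauS \<tau> (s + 1) r noshift noshift)))) \<and>
     \<comment> \<open>(3a): L = lambda^(-1), M = mu\<close>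
     (ps_diff
       (ps_pmult (pVar L) (ps_mult (tauS \<tau> s r noshift (miwa M)) (tauS \<tau> (s + 1) (r + 1) (miwa L) noshift)))
       (ps_pmult (pVar L) (ps_mult (tauS \<tau> (s + 1) (r + 1) (miwa L) (miwa M)) (tauS \<tau> s r noshift noshift)))
     = ps_diff
       (ps_pmult (pVar M) (ps_mult (tauS \<tau> (s + 1) r (miwa L) noshift) (tauS \<tau> s (r + 1) noshift (miwa M))))
       (ps_pmult (pVar M) (ps_mult (tauS \<tau> s (r + 1) (miwa L) (miwa M)) (tauS \<tau> (s + 1) r noshift noshift)))) \<and>
     \<comment> \<open>(3b): L = lambda^(-1), M = mu; multiplied by mu\<close>
     (ps_diff
       (ps_pmult (pVar M * pVar L) (ps_mult (tauS \<tau> (s - 1) (r + 1) noshift (miwa M)) (tauS \<tau> (s + 1) (r + 1) (miwa L) noshift)))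
       (ps_pmult (pVar M * pVar L) (ps_mult (tauS \<tau> s (r + 2) (miwa L) (miwa M)) (tauS \<tau> s r noshift noshift)))
     = ps_diff
       (ps_mult (tauS \<tau> s (r + 1) (miwa L) noshift) (tauS \<tau> s (r + 1) noshift (miwa M)))
       (ps_mult (tauS \<tau> s (r + 1) (miwa L) (miwa M)) (tauS \<tau> s (r + 1) noshift noshift)))"
proof -
  let ?l = "pvar L" and ?m = "pvar M"
  have l: "?l \<in> ord_ge 1" and m: "?m \<in> ord_ge 1"
    by (rule pvar_ord_ge_1)+
  note ids = identity_1a[OF assms l m, of s r] identity_1b[OF assms l m, of s r] identity_2a[OF assms l m, of s r]
    identity_2b[OF assms l m, of s r] identity_3a[OF assms l m, of s r] identity_3b[OF assms l m, of s r]
  have ne: "Ps (tauS \<tau> i j noshift noshift) = shifted (\<tau> i j) P (\<lambda>k. 0) (\<lambda>k. 0)" for i j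
    by (subst Ps_tauS) (auto simp: noshift_def)
  have t: "Ps (tauS \<tau> i j (miwa v) noshift) = shifted (\<tau> i j) P (mw (pvar v)) (\<lambda>k. 0)"
    "Ps (tauS \<tau> i j noshift (miwa v)) = shifted (\<tau> i j) P (\<lambda>k. 0) (mw (pvar v))" for i j v
    using graded_mw[OF pvar_ord_ge_1[of v]] by (simp_all add: Ps_tauS noshift_def graded_zero)
  have tt: "Ps (tauS \<tau> i j (miwa v) (miwa w)) = shifted (\<tau> i j) P (mw (pvar v)) (mw (pvar w))" for i j v w
    using graded_mw[OF pvar_ord_ge_1[of v]] graded_mw[OF pvar_ord_ge_1[of w]] by (simp add: Ps_tauS)
  have t2: "Ps (tauS \<tau> i j (miwa2 v w) noshift) = shifted (\<tau> i j) P (mw2 (pvar v) (pvar w)) (\<lambda>k. 0)"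
    "Ps (tauS \<tau> i j noshift (miwa2 v w)) = shifted (\<tau> i j) P (\<lambda>k. 0) (mw2 (pvar v) (pvar w))" for i j v w
    using graded_add[OF graded_mw[OF pvar_ord_ge_1[of v]] graded_mw[OF pvar_ord_ge_1[of w]]]
    by (simp_all add: Ps_tauS noshift_def miwa2_def graded_zero)
  show ?thesis
    \<comment> \<open>Injectivity of \<open>Ps\<close> turns equations between coefficient functions
      into ring equations, namely the six identities at \<open>pvar L\<close> and
      \<open>pvar M\<close>.\<close>
    unfolding Ps_inject'[symmetric] Ps_add Ps_diff Ps_mult Ps_pmult ne t tt t2
      of_mpoly_mult of_mpoly_diff of_mpoly_minus of_mpoly_pVar
    by (intro conjI ids)
qed

end
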